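(* Let $K,N\ge 1$ be integers, let $m=\lceil 2K/3\rceil$, and let $G=\mathcal P(K,N)$. \begin{itemize} \item If $K\equiv 1\pmod 3$, then \begin{itemize} \item if $N\equiv 1\pmod 3$, then $\Sigma(G)$ is contractible and $Z_G(-1)=0$; \item otherwise, $\Sigma(G)$ is homotopy equivalent to a sphere of dimension $mn-1$, with $n=\lceil N/3\rceil$, and $Z_G(-1)=(-1)^n$. \end{itemize} \item If $K\equiv 2\pmod 3$, write $N=2qK+r$ with $q,r$ integers and $0\le r\le 2K-1$. Then \begin{itemize} \item if $r\equiv 1$ or $2\pmod 3$, then $\Sigma(G)$ is contractible and $Z_G(-1)=0$; \item otherwise, $\Sigma(G)$ is homotopy equivalent to a sphere of dimension $mn-1$, with $n=\left\lceil \frac{2K-1}{2K}\cdot\frac N3\right\rceil$, and $Z_G(-1)=1$. \end{itemize} \item If $K\equiv 0\pmod 3$, write $N=2q(K+1)+r$ with $q,r$ integers and $0\le r\le 2K+1$. Then \begin{itemize} \item if $r\equiv 0\pmod 3$ with $r\ge 1$, or $r\equiv 1\pmod 3$ with $r\le 2K$, then $\Sigma(G)$ is contractible and $Z_G(-1)=0$; \item otherwise, $\Sigma(G)$ is homotopy equivalent to a sphere of dimension $mn-1$, where $n=\left\lceil \frac{2K+3}{2K+2}\cdot\frac N3\right\rceil$, and $Z_G(-1)=1$. \end{itemize} \end{itemize}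
   Context: The square grid $\mathbb Z^2$ is regarded as an infinite graph, with edges joining vertices at distance $1$ from each other. For $K,N\ge 1$, the parallelogram $\mathcal P(K,N)$ is the subgraph of $\mathbb Z^2$ induced by the vertices $(x,y)\in\mathbb Z^2$ satisfying $0\le y\le K-1$ and $-y\le x\le -y+N-1$. For a finite graph $G$, an independent set is a set of pairwise non-adjacent vertices (the empty set is included). The independence complex $\Sigma(G)$ is the simplicial complex formed by all independent sets of $G$, ordered by inclusion; an independent set $I$ is a cell of dimension $|I|-1$. Topological statements about $\Sigma(G)$ refer to its geometric realization. The alternating number of independent sets of $G$ is $Z_G(-1)=\sum_{I\in\Sigma(G)}(-1)^{|I|}$, where the sum includes $I=\emptyset$. The sphere of dimension $0$ consists of two points. *)

theory Defs
  imports "HOL-Analysis.Analysis"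
begin

text \<open>A simple graph is a pair of a vertex set and a set of two-element edges.\<close>

type_synonym 'a graph = "'a set \<times> 'a set set"

definition vertices :: "'a graph \<Rightarrow> 'a set" where
  "vertices G = fst G"

definition edges :: "'a graph \<Rightarrow> 'a set set" where
  "edges G = snd G"

definition induced_subgraph :: "'a graph \<Rightarrow> 'a set \<Rightarrow> 'a graph" where
  "induced_subgraph G W = (vertices G \<inter> W, {e \<in> edges G. e \<subseteq> W})"

text \<open>The edge condition is Euclidean distance \<open>1\<close> in the plane; see \<open>grid_adjacent_iff\<close> below.\<close>

definition square_grid :: "(int \<times> int) graph" where
  "square_grid =
     (UNIV,
      {{(x, y), (x', y')} | x y x' y'.
         dist (real_of_int x, real_of_int y) (real_of_int x', real_of_int y') = 1})"

definition parallelogram :: "int \<Rightarrow> int \<Rightarrow> (int \<times> int) graph" where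
  "parallelogram K N =
     induced_subgraph square_grid
       {(x, y). 0 \<le> y \<and> y \<le> K - 1 \<and> - y \<le> x \<and> x \<le> - y + N - 1}"

definition independent_set :: "'a graph \<Rightarrow> 'a set \<Rightarrow> bool" where
  "independent_set G I \<longleftrightarrow>
     I \<subseteq> vertices G \<and> pairwise (\<lambda>u v. {u, v} \<notin> edges G) I"

text \<open>As an abstract simplicial complex, it includes the empty cell, of dimension \<open>-1\<close>.\<close>

definition independence_complex :: "'a graph \<Rightarrow> 'a set set" where
  "independence_complex G = {I. independent_set G I}"

definition alternating_number :: "'a graph \<Rightarrow> int" where
  "alternating_number G = (\<Sum>I\<in>independence_complex G. (- 1) ^ card I)"

text \<open>
  Points are given by barycentric coordinates, extended by \<open>0\<close> outside the support. For a
  complex on finitely many vertices, the product topology is the usual topology of the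
  realization. The empty cell contributes no point, since its coordinates would sum to \<open>0\<close>.
\<close>

definition geometric_realization :: "'a set set \<Rightarrow> ('a \<Rightarrow> real) topology" where
  "geometric_realization \<Delta> =
     subtopology (powertop_real UNIV)
       {t. (\<forall>v. 0 \<le> t v) \<and> {v. t v \<noteq> 0} \<in> \<Delta> \<and> (\<Sum>v | t v \<noteq> 0. t v) = 1}"

lemma vertices_parallelogram:
  "vertices (parallelogram K N) = {(x, y). 0 \<le> y \<and> y \<le> K - 1 \<and> - y \<le> x \<and> x \<le> - y + N - 1}"
  by (simp add: parallelogram_def induced_subgraph_def square_grid_def vertices_def)

lemma finite_vertices_parallelogram: "finite (vertices (parallelogram K N))"
proof (rule finite_subset)
  show "vertices (parallelogram K N) \<subseteq> {- K..N} \<times> {0..K}"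
    by (auto simp: vertices_parallelogram)
qed simp

lemma int_dist_eq_1_iff:
  "dist (real_of_int x, real_of_int y) (real_of_int x', real_of_int y') = 1
     \<longleftrightarrow> \<bar>x - x'\<bar> + \<bar>y - y'\<bar> = 1"
proof -
  have "dist (real_of_int x, real_of_int y) (real_of_int x', real_of_int y') = 1
      \<longleftrightarrow> real_of_int ((x - x')\<^sup>2 + (y - y')\<^sup>2) = real_of_int 1"
    by (simp add: dist_Pair_Pair dist_real_def)
  also have "\<dots> \<longleftrightarrow> \<bar>x - x'\<bar>\<^sup>2 + \<bar>y - y'\<bar>\<^sup>2 = 1"
    by (simp only: of_int_eq_iff power2_abs)
  also have "\<dots> \<longleftrightarrow> \<bar>x - x'\<bar> + \<bar>y - y'\<bar> = 1" (is "?a\<^sup>2 + ?b\<^sup>2 = 1 \<longleftrightarrow> _")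
  proof
    assume *: "?a\<^sup>2 + ?b\<^sup>2 = 1"
    have "z \<le> z\<^sup>2" if "0 \<le> z" for z :: int
      using that by (cases "z = 0") (auto intro: self_le_power)
    from this[of ?a] this[of ?b] have "?a \<le> ?a\<^sup>2" "?b \<le> ?b\<^sup>2"
      by (simp_all only: abs_ge_zero)
    moreover have "?a \<noteq> 0 \<or> ?b \<noteq> 0"
      using * by auto
    ultimately show "?a + ?b = 1"
      using * by linarith
  next
    assume "?a + ?b = 1"
    then consider "?a = 0" "?b = 1" | "?a = 1" "?b = 0"
      by linarith
    then show "?a\<^sup>2 + ?b\<^sup>2 = 1"
      by cases (simp_all del: power2_abs)
  qed
  finally show ?thesis .
qed

lemma grid_adjacent_iff:
  "{(x, y), (x', y')} \<in> edges square_grid \<longleftrightarrow> \<bar>x - x'\<bar> + \<bar>y - y'\<bar> = 1"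
  unfolding square_grid_def edges_def int_dist_eq_1_iff
  by (auto simp: doubleton_eq_iff abs_minus_commute)

text \<open>
  The library predicate \<^const>\<open>contractible_space\<close> holds for the empty space. This convention
  plays no role for a nonempty parallelogram.
\<close>

lemma realization_parallelogram_nonempty:
  assumes "1 \<le> K" and "1 \<le> N"
  shows "topspace (geometric_realization (independence_complex (parallelogram K N))) \<noteq> {}"
proof -
  define t :: "int \<times> int \<Rightarrow> real" where "t = (\<lambda>v. if v = (0, 0) then 1 else 0)"
  have supp: "{v. t v \<noteq> 0} = {(0, 0)}"
    by (auto simp: t_def)
  have "{(0, 0)} \<in> independence_complex (parallelogram K N)"
    using assms by (simp add: independence_complex_def independent_set_def vertices_parallelogram)
  moreover have "0 \<le> t v" for v
    by (simp add: t_def)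
  moreover have "(\<Sum>v\<in>{(0, 0)}. t v) = 1"
    by (simp add: t_def)
  ultimately have "t \<in> topspace (geometric_realization (independence_complex (parallelogram K N)))"
    unfolding geometric_realization_def by (simp add: supp)
  then show ?thesis
    by blast
qed

end

theory Submission
  imports Defs
begin

text \<open>
  Everything rests on the \<^emph>\<open>fold lemma\<close>: if every neighbour of \<open>u\<close> is a neighbour of another vertex
  \<open>v\<close>, then deleting \<open>v\<close> changes neither the homotopy type of the independence complex nor the
  alternating number. Indeed the weight of \<open>v\<close> in a point of the realization can be moved to \<open>u\<close>
  along a straight line. When folds reduce a graph to a perfect matching of \<open>k\<close> isolated edges, its
  complex is the boundary of a \<open>k\<close>-dimensional cross-polytope, hence a sphere of dimension \<open>k - 1\<close>
  (\<open>homeomorphic_cross_polytope_sphere\<close>), and the alternating number is \<open>(- 1) ^ k\<close>. When they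
  lead to a graph with an isolated vertex, the complex is a cone. It turns out that every
  parallelogram reduces to one of these two situations by folds alone. The relation
  \<open>dismantles n W W'\<close> records such a reduction, where \<open>n\<close> isolated edges are split off on the way.

  In the coordinates \<open>s = x + y\<close> and \<open>y\<close>, the parallelogram is the rectangle \<open>0 \<le> s < N\<close>,
  \<open>0 \<le> y < K\<close>. The columns \<open>s = const\<close> are independent sets, and two consecutive columns
  induce a zigzag path with \<open>2K\<close> vertices. Two reductions suffice. If \<open>(x, y)\<close> has no neighbour to
  the left or below, it folds away \<open>(x + 1, y + 1)\<close> (\<open>corner_folds\<close>); so a column at the left end
  clears the corresponding part of the second column after it. A zigzag path that ends in a leaf is then
  consumed three vertices at a time, one isolated edge for every three vertices
  (\<open>dismantles_zigzag\<close>). The length modulo \<open>3\<close> determines what happens at its other end.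

  A full strip of width at least \<open>3\<close> thus yields \<open>m = \<lceil>2K/3\<rceil>\<close> edges and loses three columns, up to
  a correction that depends on \<open>K\<close> modulo \<open>3\<close>:
  \<^item> for \<open>K \<equiv> 1\<close> exactly three columns disappear;
  \<^item> for \<open>K \<equiv> 0\<close> a single vertex of the third column survives. The partial column left over grows
    by one or two vertices in each later step, and after \<open>(2K + 3)/3\<close> steps it is a full
    column, so that \<open>2K + 2\<close> columns have disappeared in total;
  \<^item> for \<open>K \<equiv> 2\<close> two vertices of the fourth column are lost as well. The defect grows by three vertices
    every two steps, and after \<open>(2K - 1)/3\<close> steps \<open>2K\<close> columns have disappeared in total.

  These are the periods in the statement. What remains after the last full period is a narrow strip,
  on which the same steps end in the empty graph or in an isolated vertex.
\<close>

section \<open>Realizations of independence complexes\<close>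

locale simple_graph =
  fixes adj :: "'a \<Rightarrow> 'a \<Rightarrow> bool"
  assumes adj_sym: "adj u v \<Longrightarrow> adj v u"
    and adj_irrefl: "\<not> adj v v"
begin

text \<open>
  The ambient graph stays fixed and only the vertex set shrinks, so that a reduction of \<open>W\<close> is a
  chain of subsets of \<open>W\<close>.
\<close>
definition indep :: "'a set \<Rightarrow> 'a set set" where
  "indep W = {I. I \<subseteq> W \<and> (\<forall>u\<in>I. \<forall>v\<in>I. \<not> adj u v)}"

definition indep_number :: "'a set \<Rightarrow> int" where
  "indep_number W = (\<Sum>I\<in>indep W. (- 1) ^ card I)"

text \<open>
  The realization by conditions on single coordinates and edges, which are easier to check for a
  map than membership of its support in the complex.
\<close>
definition points :: "'a set \<Rightarrow> ('a \<Rightarrow> real) set" where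
  "points W = {t. (\<forall>v. 0 \<le> t v) \<and> (\<forall>v. v \<notin> W \<longrightarrow> t v = 0) \<and>
     (\<forall>u v. adj u v \<longrightarrow> t u = 0 \<or> t v = 0) \<and> sum t W = 1}"

lemma realization_indep:
  assumes "finite W"
  shows "geometric_realization (indep W) = subtopology (powertop_real UNIV) (points W)"
proof -
  have "(\<Sum>v | t v \<noteq> 0. t v) = sum t W" if "{v. t v \<noteq> 0} \<subseteq> W" for t :: "'a \<Rightarrow> real"
    using that assms by (intro sum.mono_neutral_left) auto
  moreover have "{v. t v \<noteq> 0} \<in> indep W \<longleftrightarrow>
      (\<forall>v. v \<notin> W \<longrightarrow> t v = 0) \<and> (\<forall>u v. adj u v \<longrightarrow> t u = 0 \<or> t v = 0)" for t :: "'a \<Rightarrow> real"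
    unfolding indep_def by blast
  moreover have "{v. t v \<noteq> 0} \<subseteq> W \<longleftrightarrow> (\<forall>v. v \<notin> W \<longrightarrow> t v = 0)" for t :: "'a \<Rightarrow> real"
    by blast
  ultimately have "{t. (\<forall>v. 0 \<le> t v) \<and> {v. t v \<noteq> 0} \<in> indep W \<and> (\<Sum>v | t v \<noteq> 0. t v) = 1} = points W"
    unfolding points_def by (intro Collect_cong) auto
  then show ?thesis
    by (simp add: geometric_realization_def)
qed

lemma topspace_realization:
  assumes "finite W"
  shows "topspace (geometric_realization (indep W)) = points W"
  by (simp add: realization_indep[OF assms])

lemma continuous_map_coordinate [continuous_intros]:
  assumes "finite W"
  shows "continuous_map (geometric_realization (indep W)) euclideanreal (\<lambda>t. t v)"
  unfolding realization_indep[OF assms]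
  by (intro continuous_map_from_subtopology continuous_map_product_projection) simp

lemma continuous_map_into_realization:
  assumes "finite W" and "\<And>v. continuous_map X euclideanreal (\<lambda>x. f x v)"
    and "\<And>x. x \<in> topspace X \<Longrightarrow> f x \<in> points W"
  shows "continuous_map X (geometric_realization (indep W)) f"
  unfolding realization_indep[OF assms(1)]
  by (rule continuous_map_into_subtopology) (use assms in \<open>auto simp: continuous_map_componentwise_UNIV\<close>)

text \<open>
  If the supports of \<open>f x\<close> and \<open>g x\<close> always span a common cell, the segment between the two points
  lies in that cell, and the straight-line homotopy stays in the complex.
\<close>
lemma contiguous_maps_homotopic:
  assumes fin: "finite W"
    and f: "continuous_map X (geometric_realization (indep W)) f"
    and g: "continuous_map X (geometric_realization (indep W)) g"
    and contig: "\<And>x u v. x \<in> topspace X \<Longrightarrow> adj u v \<Longrightarrow>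
      f x u = 0 \<and> g x u = 0 \<or> f x v = 0 \<and> g x v = 0"
  shows "homotopic_with (\<lambda>_. True) X (geometric_realization (indep W)) f g"
proof -
  define h where "h = (\<lambda>(\<tau>::real, x) v. (1 - \<tau>) * f x v + \<tau> * g x v)"
  have fv: "continuous_map X euclideanreal (\<lambda>x. f x v)" for v
    using continuous_map_compose[OF f continuous_map_coordinate[OF fin]] by (simp add: o_def)
  have gv: "continuous_map X euclideanreal (\<lambda>x. g x v)" for v
    using continuous_map_compose[OF g continuous_map_coordinate[OF fin]] by (simp add: o_def)
  let ?P = "prod_topology (top_of_set {0..1::real}) X"
  have 1: "continuous_map ?P euclideanreal fst"
    using continuous_map_fst[of "top_of_set {0..1::real}" X] continuous_map_into_fulltopology by blast
  have 2: "continuous_map ?P X snd"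
    by (rule continuous_map_snd)
  have "continuous_map ?P (geometric_realization (indep W)) h"
  proof (rule continuous_map_into_realization[OF fin])
    fix v
    have "continuous_map ?P euclideanreal (\<lambda>p. f (snd p) v)" "continuous_map ?P euclideanreal (\<lambda>p. g (snd p) v)"
      using continuous_map_compose[OF 2 fv] continuous_map_compose[OF 2 gv] by (simp_all add: o_def)
    then show "continuous_map ?P euclideanreal (\<lambda>p. h p v)"
      unfolding h_def case_prod_beta by (intro continuous_intros 1) auto
  next
    fix p assume p: "p \<in> topspace ?P"
    obtain \<tau> x where px: "p = (\<tau>, x)" by fastforce
    have x: "x \<in> topspace X" and \<tau>: "0 \<le> \<tau>" "\<tau> \<le> 1"
      using p px by auto
    have fx: "f x \<in> points W" and gx: "g x \<in> points W"
      using f g x unfolding continuous_map_def topspace_realization[OF fin] by auto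
    have "sum (h p) W = (1 - \<tau>) * sum (f x) W + \<tau> * sum (g x) W"
      by (simp add: h_def px sum.distrib sum_distrib_left)
    then show "h p \<in> points W"
      using fx gx \<tau> contig[OF x] unfolding points_def h_def px by fastforce
  qed
  moreover have "h (0, x) = f x" "h (1, x) = g x" for x
    by (simp_all add: h_def fun_eq_iff)
  ultimately show ?thesis
    unfolding homotopic_with_def by (intro exI[of _ h]) auto
qed

lemma contractible_cone:
  assumes fin: "finite W" and "x \<in> W" and iso: "\<And>v. v \<in> W \<Longrightarrow> \<not> adj x v"
  shows "contractible_space (geometric_realization (indep W))"
proof -
  let ?X = "geometric_realization (indep W)"
  define e :: "'a \<Rightarrow> real" where "e = (\<lambda>v. if v = x then 1 else 0)"
  have e: "e \<in> points W"
    using assms adj_irrefl by (auto simp: points_def e_def)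
  have "homotopic_with (\<lambda>_. True) ?X ?X id (\<lambda>_. e)"
  proof (rule contiguous_maps_homotopic[OF fin])
    show "continuous_map ?X ?X (\<lambda>_. e)"
      using e by (simp add: topspace_realization[OF fin])
    fix t u v assume t: "t \<in> topspace ?X" and uv: "adj u v"
    have off: "t w = 0" if "adj x w" for w
      using iso[of w] that t by (auto simp: topspace_realization[OF fin] points_def)
    have "t u = 0 \<or> t v = 0"
      using t uv by (auto simp: topspace_realization[OF fin] points_def)
    then show "id t u = 0 \<and> e u = 0 \<or> id t v = 0 \<and> e v = 0"
      using off[of u] off[of v] uv adj_sym[OF uv] adj_irrefl by (auto simp: e_def)
  qed auto
  then show ?thesis
    unfolding contractible_space_def by blast
qed

text \<open>
  The retraction gives all the weight of \<open>v\<close> to \<open>u\<close>. A cell that contains \<open>v\<close> avoids the neighbours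
  of \<open>v\<close>, hence those of \<open>u\<close>, so it can be enlarged by \<open>u\<close>: the retraction is contiguous to the
  identity.
\<close>
lemma homotopy_equivalent_fold:
  assumes fin: "finite W" and u: "u \<in> W" and v: "v \<in> W" and "u \<noteq> v"
    and dom: "\<And>w. w \<in> W \<Longrightarrow> adj u w \<Longrightarrow> adj v w"
  shows "geometric_realization (indep W) homotopy_equivalent_space
    geometric_realization (indep (W - {v}))"
proof -
  let ?X = "geometric_realization (indep W)" and ?Y = "geometric_realization (indep (W - {v}))"
  define r :: "('a \<Rightarrow> real) \<Rightarrow> 'a \<Rightarrow> real" where "r = (\<lambda>t. t(u := t u + t v, v := 0))"
  have finY: "finite (W - {v})" using fin by simp
  have sub: "t \<in> points W" if "t \<in> points (W - {v})" for t
    using that v fin by (auto simp: points_def sum.remove[of W v])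
  have contig: "t a = 0 \<and> r t a = 0 \<or> t b = 0 \<and> r t b = 0" if "t \<in> points W" "adj a b" for t a b
  proof (cases "t v = 0")
    case True
    then show ?thesis using that \<open>u \<noteq> v\<close> by (auto simp: points_def r_def)
  next
    case False
    have "t w = 0" if "adj v w" for w
      using that False \<open>t \<in> points W\<close> by (auto simp: points_def)
    then have "t w = 0" if "adj u w" for w
      using that dom \<open>t \<in> points W\<close> unfolding points_def by auto
    with \<open>\<And>w. adj v w \<Longrightarrow> t w = 0\<close> show ?thesis
      using that adj_sym adj_irrefl dom v False \<open>u \<noteq> v\<close> unfolding points_def r_def
      by simp (metis)
  qed
  have rW: "r t \<in> points (W - {v})" if t: "t \<in> points W" for t
  proof -
    have "sum (r t) (W - {v}) = (t u + t v) + sum t (W - {v} - {u})"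
      using u v fin \<open>u \<noteq> v\<close> by (simp add: sum.remove[of "W - {v}" u] r_def)
    also have "\<dots> = sum t W"
      using u v fin \<open>u \<noteq> v\<close> by (simp add: sum.remove[of W v] sum.remove[of "W - {v}" u])
    finally have "sum (r t) (W - {v}) = sum t W" .
    moreover have "r t a = 0 \<or> r t b = 0" if "adj a b" for a b
      using contig[OF t that] by blast
    moreover have "0 \<le> r t w" "w \<notin> W - {v} \<longrightarrow> r t w = 0" for w
      using t u \<open>u \<noteq> v\<close> by (auto simp: points_def r_def)
    ultimately show ?thesis
      using t unfolding points_def by simp
  qed
  have cont: "continuous_map ?X euclideanreal (\<lambda>t. r t w)" for w
    unfolding r_def fun_upd_apply using fin
    by (cases "w = v"; cases "w = u") (auto intro!: continuous_intros)
  have rX: "continuous_map ?X ?X r" and rY: "continuous_map ?X ?Y r"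
    by (rule continuous_map_into_realization; use fin cont rW sub topspace_realization in auto)+
  have "homotopic_with (\<lambda>_. True) ?X ?X r id"
    by (rule contiguous_maps_homotopic[OF fin rX continuous_map_id])
      (use contig in \<open>auto simp: topspace_realization[OF fin]\<close>)
  moreover have "retraction_maps ?X ?Y r id"
  proof -
    have "continuous_map ?Y ?X id"
      by (rule continuous_map_into_realization)
        (use fin sub finY in \<open>auto simp: topspace_realization intro: continuous_intros\<close>)
    moreover have "r t = t" if "t \<in> points (W - {v})" for t
      using that by (auto simp: r_def points_def fun_eq_iff)
    ultimately show ?thesis
      using rY by (simp add: retraction_maps_def topspace_realization[OF finY])
  qed
  ultimately show ?thesis
    by (rule deformation_retract_imp_homotopy_equivalent_space)
qed

section \<open>Induced matchings and cross-polytopes\<close>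
definition induced_matching :: "nat \<Rightarrow> (nat \<Rightarrow> 'a) \<Rightarrow> (nat \<Rightarrow> 'a) \<Rightarrow> bool" where
  "induced_matching k a b \<longleftrightarrow>
     (\<forall>i<k. adj (a i) (b i)) \<and>
     (\<forall>i<k. \<forall>j<k. i \<noteq> j \<longrightarrow> a i \<noteq> a j \<and> a i \<noteq> b j \<and> b i \<noteq> b j \<and>
        \<not> adj (a i) (a j) \<and> \<not> adj (a i) (b j) \<and> \<not> adj (b i) (b j))"

definition endpoints :: "nat \<Rightarrow> (nat \<Rightarrow> 'a) \<Rightarrow> (nat \<Rightarrow> 'a) \<Rightarrow> 'a set" where
  "endpoints k a b = a ` {..<k} \<union> b ` {..<k}"

lemma induced_matching_adj:
  assumes M: "induced_matching k a b" and uv: "u \<in> endpoints k a b" "v \<in> endpoints k a b" "adj u v"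
  shows "\<exists>i<k. u = a i \<and> v = b i \<or> u = b i \<and> v = a i"
proof -
  obtain i where i: "i < k" "u = a i \<or> u = b i" using uv by (auto simp: endpoints_def)
  obtain j where j: "j < k" "v = a j \<or> v = b j" using uv by (auto simp: endpoints_def)
  have "i = j"
    using M i j uv(3) adj_sym unfolding induced_matching_def by metis
  then show ?thesis using i j uv(3) adj_irrefl by blast
qed

lemma sum_endpoints:
  assumes "induced_matching k a b"
  shows "sum f (endpoints k a b) = (\<Sum>i<k. f (a i) + f (b i))"
proof -
  have "inj_on a {..<k}" "inj_on b {..<k}" "a ` {..<k} \<inter> b ` {..<k} = {}"
    using assms adj_irrefl unfolding induced_matching_def inj_on_def
    by (force, force, auto) metis
  then show ?thesis
    unfolding endpoints_def by (simp add: sum.union_disjoint sum.reindex sum.distrib)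
qed

text \<open>
  An independent set contains at most one end of each edge, so the difference of the two weights
  on an edge loses no information. These differences are the points of the unit sphere of the
  \<open>\<ell>\<^sup>1\<close>-norm, and radial projection identifies that with the Euclidean sphere.
\<close>
lemma homeomorphic_cross_polytope_sphere:
  assumes M: "induced_matching k a b" and "0 < k"
  shows "geometric_realization (indep (endpoints k a b)) homeomorphic_space nsphere (k - 1)"
proof -
  let ?X = "geometric_realization (indep (endpoints k a b))"
  have fin: "finite (endpoints k a b)" by (simp add: endpoints_def)
  have idx: "{..k - Suc 0} = {..<k}" "\<And>i. k - Suc 0 < i \<longleftrightarrow> k \<le> i" using \<open>0 < k\<close> by auto
  define S where "S = nsphere (k - 1)"
  have Stop: "topspace S = {x. (\<Sum>i<k. x i ^ 2) = 1 \<and> (\<forall>i\<ge>k. x i = 0)}"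
    by (simp add: S_def nsphere idx)
  have S: "S = subtopology (powertop_real UNIV) (topspace S)"
    unfolding Stop by (simp add: S_def nsphere idx)
  have aj: "adj (a i) (b i)" if "i < k" for i using M that by (auto simp: induced_matching_def)
  have ne: "a i \<noteq> b j" if "i < k" "j < k" for i j
    using M that adj_irrefl unfolding induced_matching_def by metis
  have inja: "a i = a j \<longleftrightarrow> i = j" and injb: "b i = b j \<longleftrightarrow> i = j" if "i < k" "j < k" for i j
    using M that unfolding induced_matching_def by metis+

  define d where "d = (\<lambda>(t :: 'a \<Rightarrow> real) i. t (a i) - t (b i))"
  define f where "f = (\<lambda>t i. if i < k then d t i / sqrt (\<Sum>j<k. (d t j)\<^sup>2) else 0)"
  define g :: "(nat \<Rightarrow> real) \<Rightarrow> 'a \<Rightarrow> real" where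
    "g = (\<lambda>x v. (\<Sum>i<k. if v = a i then max (x i) 0 else if v = b i then max (- x i) 0 else 0) / (\<Sum>i<k. \<bar>x i\<bar>))"
  have ga: "g x (a i) = max (x i) 0 / (\<Sum>i<k. \<bar>x i\<bar>)"
    and gb: "g x (b i) = max (- x i) 0 / (\<Sum>i<k. \<bar>x i\<bar>)" if "i < k" for x i
  proof -
    have "(\<Sum>j<k. if a i = a j then max (x j) 0 else if a i = b j then max (- x j) 0 else 0)
      = (\<Sum>j<k. if j = i then max (x i) 0 else 0)"
      by (rule sum.cong) (use that ne inja in auto)
    then show "g x (a i) = max (x i) 0 / (\<Sum>i<k. \<bar>x i\<bar>)" using that by (simp add: g_def)
    have "(\<Sum>j<k. if b i = a j then max (x j) 0 else if b i = b j then max (- x j) 0 else 0)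
      = (\<Sum>j<k. if j = i then max (- x i) 0 else 0)"
      by (rule sum.cong) (use that ne injb in \<open>auto simp: eq_commute[of "b i" "a _"]\<close>)
    then show "g x (b i) = max (- x i) 0 / (\<Sum>i<k. \<bar>x i\<bar>)" using that by (simp add: g_def)
  qed
  have g0: "g x v = 0" if "v \<notin> endpoints k a b" for x v
  proof -
    have "(\<Sum>i<k. if v = a i then max (x i) 0 else if v = b i then max (- x i) 0 else 0) = 0"
      by (rule sum.neutral) (use that in \<open>auto simp: endpoints_def\<close>)
    then show ?thesis by (simp add: g_def)
  qed
  have l1pos: "(\<Sum>i<k. \<bar>x i\<bar>) > 0" if "x \<in> topspace S" for x
  proof (rule ccontr)
    assume "\<not> ?thesis"
    then have "(\<Sum>i<k. \<bar>x i\<bar>) = 0" using sum_nonneg[of "{..<k}" "\<lambda>i. \<bar>x i\<bar>"] by fastforce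
    then have "\<forall>i<k. x i = 0" by (simp add: sum_nonneg_eq_0_iff)
    then show False using that by (simp add: Stop)
  qed
  have zero: "t (a i) = 0 \<or> t (b i) = 0" if "t \<in> points (endpoints k a b)" "i < k" for t i
    using that aj by (auto simp: points_def)
  have nn: "0 \<le> t v" if "t \<in> points (endpoints k a b)" for t v
    using that by (auto simp: points_def)
  have dabs: "\<bar>d t i\<bar> = t (a i) + t (b i)" if "t \<in> points (endpoints k a b)" "i < k" for t i
    using zero[OF that] nn[OF that(1)] by (auto simp: d_def)
  have d1: "(\<Sum>i<k. \<bar>d t i\<bar>) = 1" if "t \<in> points (endpoints k a b)" for t
    using that dabs[OF that] sum_endpoints[OF M, of t] by (simp add: points_def)
  have l2pos: "(\<Sum>j<k. (d t j)\<^sup>2) > 0" if "t \<in> points (endpoints k a b)" for t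
  proof (rule ccontr)
    assume "\<not> ?thesis"
    then have "(\<Sum>j<k. (d t j)\<^sup>2) = 0" using sum_nonneg[of "{..<k}" "\<lambda>i. (d t i)\<^sup>2"] by fastforce
    then have "\<forall>i<k. d t i = 0" by (simp add: sum_nonneg_eq_0_iff)
    then show False using d1[OF that] by simp
  qed
  have cd: "continuous_map ?X euclideanreal (\<lambda>t. d t i)" for i
    unfolding d_def using fin by (intro continuous_intros) auto
  have cX: "continuous_map ?X S f"
  proof (subst S, rule continuous_map_into_subtopology)
    show "continuous_map ?X (powertop_real UNIV) f"
      unfolding continuous_map_componentwise_UNIV
    proof
      fix i
      show "continuous_map ?X euclideanreal (\<lambda>t. f t i)"
        unfolding f_def using l2pos fin
        by (cases "i < k")
          (auto intro!: continuous_map_real_divide cd continuous_map_sqrt continuous_map_sum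
            continuous_map_real_pow simp: topspace_realization less_le)
    qed
    show "f \<in> topspace ?X \<rightarrow> topspace S"
    proof
      fix t assume "t \<in> topspace ?X"
      then have t: "t \<in> points (endpoints k a b)" by (simp add: topspace_realization fin)
      have "(\<Sum>i<k. (f t i)\<^sup>2) = (\<Sum>i<k. (d t i)\<^sup>2 / (\<Sum>j<k. (d t j)\<^sup>2))"
        by (rule sum.cong) (use l2pos[OF t] in \<open>auto simp: f_def power_divide\<close>)
      then have "(\<Sum>i<k. (f t i)\<^sup>2) = 1"
        using l2pos[OF t] by (simp flip: sum_divide_distrib)
      then show "f t \<in> topspace S" by (simp add: Stop f_def)
    qed
  qed
  have cS: "continuous_map S euclideanreal (\<lambda>x. x i)" for i
    unfolding S_def by (rule continuous_map_nsphere_projection)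
  have gp: "g x \<in> points (endpoints k a b)" if x: "x \<in> topspace S" for x
  proof -
    have pos: "0 \<le> g x v" for v
      unfolding g_def by (intro divide_nonneg_nonneg sum_nonneg) auto
    have "g x (a i) = 0 \<or> g x (b i) = 0" if "i < k" for i
      using ga[OF that] gb[OF that] by (cases "x i \<le> 0") auto
    then have edge: "adj u v \<Longrightarrow> g x u = 0 \<or> g x v = 0" for u v
      using induced_matching_adj[OF M, of u v] g0 by blast
    have "sum (g x) (endpoints k a b) = (\<Sum>i<k. \<bar>x i\<bar> / (\<Sum>i<k. \<bar>x i\<bar>))"
      unfolding sum_endpoints[OF M]
      by (rule sum.cong) (auto simp: ga gb simp flip: add_divide_distrib)
    also have "\<dots> = 1" using l1pos[OF x] by (simp flip: sum_divide_distrib)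
    finally show ?thesis using pos edge g0 by (auto simp: points_def)
  qed
  have cg: "continuous_map S ?X g"
  proof (rule continuous_map_into_realization[OF fin _ gp])
    fix v
    have "continuous_map S euclideanreal
        (\<lambda>x. if v = a i then max (x i) 0 else if v = b i then max (- x i) 0 else 0)" for i
      by (cases "v = a i"; cases "v = b i") (auto intro!: continuous_intros cS)
    then show "continuous_map S euclideanreal (\<lambda>x. g x v)"
      unfolding g_def using l1pos
      by (intro continuous_map_real_divide continuous_map_sum continuous_map_real_abs cS)
        (auto simp: less_le)
  qed
  have gf: "g (f t) = t" if t: "t \<in> points (endpoints k a b)" for t
  proof
    fix v
    define c where "c = sqrt (\<Sum>j<k. (d t j)\<^sup>2)"
    have c: "c > 0" using l2pos[OF t] by (simp add: c_def)
    have fi: "f t i = d t i / c" if "i < k" for i using that by (simp add: f_def c_def)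
    have "(\<Sum>i<k. \<bar>f t i\<bar>) = (\<Sum>i<k. \<bar>d t i\<bar> / c)"
      by (rule sum.cong) (use c in \<open>auto simp: fi\<close>)
    then have l: "(\<Sum>i<k. \<bar>f t i\<bar>) = 1 / c" using d1[OF t] by (simp flip: sum_divide_distrib)
    show "g (f t) v = t v"
    proof (cases "v \<in> endpoints k a b")
      case False
      then show ?thesis using t g0 by (auto simp: points_def)
    next
      case True
      have "g (f t) (a i) = t (a i)" "g (f t) (b i) = t (b i)" if i: "i < k" for i
      proof -
        have "g (f t) (a i) = max (d t i / c) 0 * c" "g (f t) (b i) = max (- (d t i / c)) 0 * c"
          unfolding ga[OF i] gb[OF i] l fi[OF i] by simp_all
        then show "g (f t) (a i) = t (a i)" "g (f t) (b i) = t (b i)"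
          using zero[OF t i] nn[OF t, of "a i"] nn[OF t, of "b i"] c
          by (auto simp: d_def max_def divide_le_0_iff)
      qed
      then show ?thesis using True by (auto simp: endpoints_def)
    qed
  qed
  have fg: "f (g x) = x" if x: "x \<in> topspace S" for x
  proof
    fix i
    define s where "s = (\<Sum>i<k. \<bar>x i\<bar>)"
    have s: "s > 0" using l1pos[OF x] by (simp add: s_def)
    have dg: "d (g x) j = x j / s" if "j < k" for j
      using s that by (auto simp: d_def ga gb s_def[symmetric] max_def field_simps)
    have "(\<Sum>j<k. (d (g x) j)\<^sup>2) = (\<Sum>j<k. (x j)\<^sup>2 / s\<^sup>2)"
      by (rule sum.cong) (auto simp: dg power_divide)
    also have "\<dots> = 1 / s\<^sup>2" using x by (simp add: Stop flip: sum_divide_distrib)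
    finally have "sqrt (\<Sum>j<k. (d (g x) j)\<^sup>2) = 1 / s" using s by (simp add: real_sqrt_divide)
    then show "f (g x) i = x i" using x s by (auto simp: f_def dg Stop)
  qed
  have "homeomorphic_maps ?X S f g"
    unfolding homeomorphic_maps_def using cX cg gf fg by (simp add: topspace_realization fin)
  then show ?thesis unfolding S_def homeomorphic_space_def by blast
qed

section \<open>The alternating number\<close>
lemma finite_indep: "finite W \<Longrightarrow> finite (indep W)"
  unfolding indep_def by (rule finite_subset[of _ "Pow W"]) auto

text \<open>The independent sets that contain \<open>v\<close> correspond to those that avoid \<open>v\<close> and its neighbours.\<close>
lemma indep_number_delete:
  assumes fin: "finite W" and v: "v \<in> W"
  shows "indep_number W = indep_number (W - {v}) - indep_number (W - {v} - {w. adj v w})"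
proof -
  let ?L = "indep (W - {v} - {w. adj v w})"
  have split: "indep W = indep (W - {v}) \<union> insert v ` ?L"
  proof (intro equalityI subsetI)
    fix I assume I: "I \<in> indep W"
    show "I \<in> indep (W - {v}) \<union> insert v ` ?L"
    proof (cases "v \<in> I")
      case True
      then have "I - {v} \<in> ?L" "I = insert v (I - {v})" using I by (auto simp: indep_def)
      then show ?thesis by blast
    next
      case False
      then show ?thesis using I by (auto simp: indep_def)
    qed
  next
    fix I assume "I \<in> indep (W - {v}) \<union> insert v ` ?L"
    then show "I \<in> indep W" using v adj_sym adj_irrefl by (auto simp: indep_def)
  qed
  have inj: "inj_on (insert v) ?L"
    by (rule inj_onI) (auto simp: indep_def dest: insert_ident[THEN iffD1, rotated 2])
  have "indep_number W = indep_number (W - {v}) + (\<Sum>I\<in>insert v ` ?L. (- 1) ^ card I)"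
    unfolding indep_number_def split
    by (rule sum.union_disjoint) (use fin in \<open>auto simp: finite_indep indep_def\<close>)
  also have "(\<Sum>I\<in>insert v ` ?L. (- 1) ^ card I) = (\<Sum>I\<in>?L. - ((- 1) ^ card I) :: int)"
    unfolding sum.reindex[OF inj]
  proof (rule sum.cong)
    fix I assume "I \<in> ?L"
    then have "finite I" "v \<notin> I" using fin by (auto simp: indep_def intro: finite_subset)
    then show "((\<lambda>I. (- 1) ^ card I) \<circ> insert v) I = - ((- 1) ^ card I :: int)" by simp
  qed simp
  finally show ?thesis by (simp add: sum_negf indep_number_def)
qed

lemma indep_number_isolated:
  assumes "finite W" "x \<in> W" "\<And>v. v \<in> W \<Longrightarrow> \<not> adj x v"
  shows "indep_number W = 0"
proof -
  have "W - {x} - {w. adj x w} = W - {x}" using assms by auto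
  then show ?thesis using indep_number_delete[OF assms(1,2)] by simp
qed

text \<open>After removing \<open>v\<close> and its neighbours, \<open>u\<close> is isolated, so the second term of the recursion vanishes.\<close>
lemma indep_number_fold:
  assumes "finite W" "u \<in> W" "v \<in> W" "u \<noteq> v" "\<And>w. w \<in> W \<Longrightarrow> adj u w \<Longrightarrow> adj v w"
  shows "indep_number (W - {v}) = indep_number W"
proof -
  have "\<not> adj v u" using assms adj_sym adj_irrefl by blast
  then have "indep_number (W - {v} - {w. adj v w}) = 0"
    using assms by (intro indep_number_isolated[of _ u]) auto
  then show ?thesis using indep_number_delete[OF assms(1,3)] by simp
qed

lemma indep_number_isolated_edge:
  assumes fin: "finite W" and "a \<in> W" "b \<in> W" "adj a b"
    and "\<And>w. w \<in> W \<Longrightarrow> adj a w \<Longrightarrow> w = b" "\<And>w. w \<in> W \<Longrightarrow> adj b w \<Longrightarrow> w = a"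
  shows "indep_number W = - indep_number (W - {a, b})"
proof -
  have "a \<noteq> b" using assms adj_irrefl by blast
  have "W - {a} - {w. adj a w} = W - {a, b}" using assms(4,5) by blast
  moreover have "indep_number (W - {a}) = 0"
  proof (rule indep_number_isolated)
    show "finite (W - {a})" "b \<in> W - {a}" using fin \<open>b \<in> W\<close> \<open>a \<noteq> b\<close> by auto
    show "\<not> adj b v" if "v \<in> W - {a}" for v using that assms(6) by blast
  qed
  ultimately show ?thesis using indep_number_delete[OF fin \<open>a \<in> W\<close>] by simp
qed

lemma indep_number_matching:
  "induced_matching k a b \<Longrightarrow> indep_number (endpoints k a b) = (- 1) ^ k"
proof (induction k)
  case 0
  have "indep {} = {{}}" by (auto simp: indep_def)
  then show ?case by (simp add: endpoints_def indep_number_def)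
next
  case (Suc k)
  have M: "induced_matching k a b" using Suc.prems by (auto simp: induced_matching_def)
  have apart: "a i \<noteq> a k \<and> a i \<noteq> b k \<and> b i \<noteq> a k \<and> b i \<noteq> b k" if "i < k" for i
    using Suc.prems that unfolding induced_matching_def by (metis less_Suc_eq nat_neq_iff)
  then have "a k \<notin> endpoints k a b" "b k \<notin> endpoints k a b"
    unfolding endpoints_def by (auto simp: image_iff) metis+
  then have eq: "endpoints (Suc k) a b - {a k, b k} = endpoints k a b"
    unfolding endpoints_def by (auto simp: less_Suc_eq)
  have ad: "adj (a k) (b k)" using Suc.prems by (auto simp: induced_matching_def)
  have ends: "a k \<in> endpoints (Suc k) a b" "b k \<in> endpoints (Suc k) a b"
    by (auto simp: endpoints_def)
  have only: "w = b k" if "w \<in> endpoints (Suc k) a b" "adj (a k) w" for w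
    using induced_matching_adj[OF Suc.prems ends(1) that] apart ad adj_irrefl
    by (metis less_Suc_eq)
  have only': "w = a k" if "w \<in> endpoints (Suc k) a b" "adj (b k) w" for w
    using induced_matching_adj[OF Suc.prems ends(2) that] apart ad adj_irrefl
    by (metis less_Suc_eq)
  have "indep_number (endpoints (Suc k) a b) = - indep_number (endpoints (Suc k) a b - {a k, b k})"
    by (rule indep_number_isolated_edge[OF _ ends ad only only']) (auto simp: endpoints_def)
  then show ?case using Suc.IH[OF M] eq by simp
qed

section \<open>Dismantling a vertex set\<close>

text \<open>
  An isolated edge that appears in a reduction is set aside by the last rule. It remains part of the
  graph that is realized, but its vertices no longer need to be carried along.
\<close>
inductive dismantles :: "nat \<Rightarrow> 'a set \<Rightarrow> 'a set \<Rightarrow> bool" where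
  refl: "dismantles 0 W W"
| fold: "dismantles n W W'"
    if "u \<in> W" "v \<in> W" "u \<noteq> v" "\<And>w. w \<in> W \<Longrightarrow> adj u w \<Longrightarrow> adj v w" "dismantles n (W - {v}) W'"
| edge: "dismantles (Suc n) W W'"
    if "a \<in> W" "b \<in> W" "adj a b" "\<And>w. w \<in> W \<Longrightarrow> adj a w \<Longrightarrow> w = b"
      "\<And>w. w \<in> W \<Longrightarrow> adj b w \<Longrightarrow> w = a" "dismantles n (W - {a, b}) W'"

lemma dismantles_trans:
  "dismantles m U V \<Longrightarrow> dismantles n V W \<Longrightarrow> dismantles (m + n) U W"
proof (induction rule: dismantles.induct)
  case (fold u U v m V)
  show ?case
    by (rule dismantles.fold[OF fold.hyps(1-4) fold.IH[OF fold.prems]])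
next
  case (edge a U b m V)
  show ?case
    unfolding add_Suc by (rule dismantles.edge[OF edge.hyps(1-5) edge.IH[OF edge.prems]])
qed simp

lemma dismantles_nonempty: "dismantles n W W' \<Longrightarrow> n = 0 \<Longrightarrow> W \<noteq> {} \<Longrightarrow> W' \<noteq> {}"
proof (induction rule: dismantles.induct)
  case (fold u W v n W')
  have "W - {v} \<noteq> {}" using fold.hyps(1,3) by blast
  then show ?case by (rule fold.IH[OF fold.prems(1)])
next
  case (edge a W b n W')
  from edge.prems(1) show ?case by simp
qed

text \<open>
  The dominating vertices stay, so the deletions can be made one by one in any order.
\<close>
lemma dismantles_folds:
  assumes "finite D"
    and "\<And>v. v \<in> D \<Longrightarrow> \<exists>u\<in>W - D. \<forall>w\<in>W. adj u w \<longrightarrow> adj v w"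
  shows "dismantles 0 W (W - D)"
  using assms
proof (induction D arbitrary: W rule: finite_induct)
  case empty
  then show ?case by (simp add: refl)
next
  case (insert v D)
  have eq: "W - insert v D = (W - {v}) - D" by auto
  have "dismantles 0 (W - {v}) (W - insert v D)"
    unfolding eq
  proof (rule insert.IH)
    fix x assume "x \<in> D"
    then obtain u where "u \<in> W - insert v D" "\<forall>w\<in>W. adj u w \<longrightarrow> adj x w"
      using insert.prems[of x] by blast
    then show "\<exists>u\<in>W - {v} - D. \<forall>w\<in>W - {v}. adj u w \<longrightarrow> adj x w" by blast
  qed
  moreover obtain u where "u \<in> W - insert v D" "\<forall>w\<in>W. adj u w \<longrightarrow> adj v w"
    using insert.prems by blast
  ultimately show ?case
  proof (cases "v \<in> W")
    case True
    show ?thesis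
    proof (rule fold)
      show "u \<in> W" "u \<noteq> v" using \<open>u \<in> W - insert v D\<close> by auto
      show "adj v w" if "w \<in> W" "adj u w" for w using \<open>\<forall>w\<in>W. adj u w \<longrightarrow> adj v w\<close> that by blast
    qed fact+
  qed simp
qed

text \<open>
  A leaf \<open>a\<close> folds away all other neighbours of its neighbour \<open>b\<close>, and then the edge between \<open>a\<close> and \<open>b\<close>
  is isolated.
\<close>
lemma dismantles_leaf:
  assumes "finite W" "a \<in> W" "b \<in> W" "adj a b" and leaf: "\<And>w. w \<in> W \<Longrightarrow> adj a w \<Longrightarrow> w = b"
  shows "dismantles 1 W (W - {b} - {w. adj b w})"
proof -
  let ?D = "{w \<in> W. adj b w} - {a}"
  have "dismantles 0 W (W - ?D)"
  proof (rule dismantles_folds)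
    show "finite ?D" using \<open>finite W\<close> by simp
    fix v assume "v \<in> ?D"
    then have "adj v b" using adj_sym by blast
    then have "\<forall>w\<in>W. adj a w \<longrightarrow> adj v w" using leaf by metis
    then show "\<exists>u\<in>W - ?D. \<forall>w\<in>W. adj u w \<longrightarrow> adj v w" using \<open>a \<in> W\<close> by blast
  qed
  moreover have "dismantles 1 (W - ?D) (W - {b} - {w. adj b w})"
  proof -
    have eq: "W - ?D - {a, b} = W - {b} - {w. adj b w}"
      using adj_sym[OF \<open>adj a b\<close>] by blast
    have "dismantles (Suc 0) (W - ?D) (W - {b} - {w. adj b w})"
    proof (rule dismantles.edge)
      show "a \<in> W - ?D" "b \<in> W - ?D" using assms(2,3) adj_irrefl by blast+
      show "w = b" if "w \<in> W - ?D" "adj a w" for w using that leaf by simp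
      show "w = a" if "w \<in> W - ?D" "adj b w" for w using that by simp
      show "dismantles 0 (W - ?D - {a, b}) (W - {b} - {w. adj b w})" unfolding eq by (rule refl)
    qed fact
    then show ?thesis by simp
  qed
  ultimately show ?thesis using dismantles_trans[of 0] by simp
qed

text \<open>
  Applying the leaf rule to the first edge removes the first three vertices of the path and makes
  the fourth one a leaf. When only two vertices are left, the last application also removes all
  further neighbours of the end of the path.
\<close>
lemma dismantles_path:
  assumes "finite W" and "\<And>i. i \<le> 3 * t + 1 \<Longrightarrow> p i \<in> W"
    and "inj_on p {..3 * t + 1}"
    and "\<And>i. i \<le> 3 * t \<Longrightarrow> adj (p i) (p (Suc i))"
    and "\<And>w. w \<in> W \<Longrightarrow> adj (p 0) w \<Longrightarrow> w = p 1"
    and "\<And>i w. Suc i \<le> 3 * t \<Longrightarrow> w \<in> W \<Longrightarrow> adj (p (Suc i)) w \<Longrightarrow> w = p i \<or> w = p (Suc (Suc i))"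
  shows "dismantles (Suc t) W (W - p ` {..3 * t + 1} - {w. adj (p (3 * t + 1)) w})"
  using assms
proof (induction t arbitrary: p W)
  case 0
  have "p ` {..1} = {p 0, p 1}" by (auto simp: atMost_Suc)
  moreover have "adj (p 1) (p 0)" using "0.prems"(4)[of 0] adj_sym by simp
  ultimately have "W - {p 1} - {w. adj (p 1) w} = W - p ` {..3 * 0 + 1} - {w. adj (p (3 * 0 + 1)) w}"
    by auto
  then show ?case
    using dismantles_leaf[of W "p 0" "p 1"] "0.prems" by simp
next
  case (Suc t)
  note prems = Suc.prems
  define W1 where "W1 = W - {p 1} - {w. adj (p 1) w}"
  have p1: "adj (p 1) (p 0)" "adj (p 1) (p 2)"
    using prems(4)[of 0] prems(4)[of 1] adj_sym by (auto simp: numeral_2_eq_2)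
  have W1: "W1 = W - {p 0, p 1, p 2}"
    unfolding W1_def using prems(6)[of 0] p1 by (auto simp: numeral_2_eq_2)
  have ne: "p i \<noteq> p j" if "i \<noteq> j" "i \<le> 3 * t + 4" "j \<le> 3 * t + 4" for i j
    using prems(3) that unfolding inj_on_def by auto
  have 1: "dismantles 1 W W1"
    unfolding W1_def by (rule dismantles_leaf[of W "p 0"]) (use prems(1,2,5) prems(4)[of 0] in auto)
  have 2: "dismantles (Suc t) W1
    (W1 - (\<lambda>i. p (i + 3)) ` {..3 * t + 1} - {w. adj (p (3 * t + 1 + 3)) w})"
  proof (rule Suc.IH)
    show "finite W1" using prems(1) by (simp add: W1)
    show "p (i + 3) \<in> W1" if "i \<le> 3 * t + 1" for i
      unfolding W1 using that prems(2)[of "i + 3"] ne[of "i + 3"] by auto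
    show "inj_on (\<lambda>i. p (i + 3)) {..3 * t + 1}"
    proof (rule inj_onI)
      fix i j assume "i \<in> {..3 * t + 1}" "j \<in> {..3 * t + 1}" "p (i + 3) = p (j + 3)"
      then show "i = j" using ne[of "i + 3" "j + 3"] by auto
    qed
    show "adj (p (i + 3)) (p (Suc i + 3))" if "i \<le> 3 * t" for i
      using that prems(4)[of "i + 3"] by simp
    show "w = p (1 + 3)" if "w \<in> W1" "adj (p (0 + 3)) w" for w
      using that prems(6)[of 2 w] by (auto simp: W1 numeral_eq_Suc)
    show "w = p (i + 3) \<or> w = p (Suc (Suc i) + 3)"
      if "Suc i \<le> 3 * t" "w \<in> W1" "adj (p (Suc i + 3)) w" for i w
      using that prems(6)[of "i + 3" w] by (auto simp: W1)
  qed
  have "{..3 * Suc t + 1} = {0, 1, 2} \<union> (\<lambda>i. i + 3) ` {..3 * t + 1}"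
  proof (intro equalityI subsetI)
    fix i assume "i \<in> {..3 * Suc t + 1}"
    then show "i \<in> {0, 1, 2} \<union> (\<lambda>i. i + 3) ` {..3 * t + 1}"
      by (cases "i < 3") (auto intro!: image_eqI[of _ _ "i - 3"])
  qed auto
  then have "p ` {..3 * Suc t + 1} = {p 0, p 1, p 2} \<union> (\<lambda>i. p (i + 3)) ` {..3 * t + 1}"
    by (simp add: image_Un image_image)
  then have "W1 - (\<lambda>i. p (i + 3)) ` {..3 * t + 1} - {w. adj (p (3 * t + 1 + 3)) w}
    = W - p ` {..3 * Suc t + 1} - {w. adj (p (3 * Suc t + 1)) w}"
    unfolding W1 by (simp add: Diff_Int_distrib Un_Diff) blast
  with dismantles_trans[OF 1 2] show ?case by simp
qed

text \<open>
  The matching that has been set aside has no edges to the current vertex set, so it does not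
  interfere with folds there.
\<close>
lemma dismantles_realization:
  assumes "dismantles n W W'" and "finite W" and "induced_matching k a b"
    and "endpoints k a b \<inter> W = {}"
    and "\<And>u v. u \<in> endpoints k a b \<Longrightarrow> v \<in> W \<Longrightarrow> \<not> adj u v"
  shows "\<exists>a' b'. induced_matching (k + n) a' b' \<and>
    endpoints (k + n) a' b' \<inter> W' = {} \<and> finite W' \<and>
    (\<forall>u\<in>endpoints (k + n) a' b'. \<forall>v\<in>W'. \<not> adj u v) \<and>
    geometric_realization (indep (endpoints k a b \<union> W)) homotopy_equivalent_space
      geometric_realization (indep (endpoints (k + n) a' b' \<union> W')) \<and>
    indep_number (endpoints k a b \<union> W) = indep_number (endpoints (k + n) a' b' \<union> W')"
  using assms
proof (induction arbitrary: k a b rule: dismantles.induct)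
  case (refl W)
  then show ?case by (intro exI[of _ a] exI[of _ b]) (auto simp: homotopy_equivalent_space_refl)
next
  case (fold u W v n W')
  let ?M = "endpoints k a b"
  have fin: "finite (?M \<union> W)" using fold.prems by (simp add: endpoints_def)
  have eq: "?M \<union> W - {v} = ?M \<union> (W - {v})" using fold.prems(3) fold.hyps(2) by blast
  have uv: "u \<in> ?M \<union> W" "v \<in> ?M \<union> W" using fold.hyps by blast+
  have dom: "adj v w" if "w \<in> ?M \<union> W" "adj u w" for w
    using that fold.hyps(1,4) fold.prems(4) adj_sym by blast
  have hom: "geometric_realization (indep (?M \<union> W)) homotopy_equivalent_space
      geometric_realization (indep (?M \<union> (W - {v})))"
    using homotopy_equivalent_fold[OF fin uv fold.hyps(3) dom] unfolding eq .
  have num: "indep_number (?M \<union> W) = indep_number (?M \<union> (W - {v}))"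
    using indep_number_fold[OF fin uv fold.hyps(3) dom] unfolding eq by simp
  have fin': "finite (W - {v})" and disj: "?M \<inter> (W - {v}) = {}"
    using fold.prems(1,3) by auto
  have far: "\<not> adj x y" if "x \<in> ?M" "y \<in> W - {v}" for x y
    using fold.prems(4) that by simp
  show ?case
    using fold.IH[OF fin' fold.prems(2) disj far] homotopy_eqv_trans[OF hom] unfolding num by blast
next
  case (edge x W y n W')
  define a' where "a' = a(k := x)"
  define b' where "b' = b(k := y)"
  have M: "endpoints (Suc k) a' b' = insert x (insert y (endpoints k a b))"
    by (auto simp: endpoints_def a'_def b'_def less_Suc_eq)
  have ends: "a i \<in> endpoints k a b" "b i \<in> endpoints k a b" if "i < k" for i
    using that by (auto simp: endpoints_def)
  have new: "\<not> adj u x \<and> \<not> adj u y \<and> \<not> adj x u \<and> \<not> adj y u \<and> u \<noteq> x \<and> u \<noteq> y \<and> x \<noteq> u \<and> y \<noteq> u"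
    if "u \<in> endpoints k a b" for u
    using that edge.prems(3,4) edge.hyps(1,2) adj_sym by blast
  have ind: "induced_matching (Suc k) a' b'"
    using edge.prems(2) edge.hyps(3) new[OF ends(1)] new[OF ends(2)]
    unfolding induced_matching_def a'_def b'_def by (simp add: less_Suc_eq)
  have fin: "finite (W - {x, y})" and disj: "endpoints (Suc k) a' b' \<inter> (W - {x, y}) = {}"
    using edge.prems(1,3) unfolding M by auto
  have far: "\<not> adj u v" if "u \<in> endpoints (Suc k) a' b'" "v \<in> W - {x, y}" for u v
    using that edge.prems(4)[of u v] edge.hyps(4)[of v] edge.hyps(5)[of v] unfolding M by auto
  have eq: "endpoints (Suc k) a' b' \<union> (W - {x, y}) = endpoints k a b \<union> W"
    unfolding M using edge.hyps(1,2) by blast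
  show ?case using edge.IH[OF fin ind disj far] unfolding eq by simp
qed

lemma dismantles_to_empty:
  assumes "dismantles n W {}" "finite W" "0 < n"
  shows "geometric_realization (indep W) homotopy_equivalent_space nsphere (n - 1) \<and>
    indep_number W = (- 1) ^ n"
proof -
  have "\<exists>a' b'. induced_matching n a' b' \<and>
    geometric_realization (indep W) homotopy_equivalent_space
      geometric_realization (indep (endpoints n a' b')) \<and>
    indep_number W = indep_number (endpoints n a' b')"
    using dismantles_realization[OF assms(1,2), of 0 undefined undefined]
    by (auto simp: endpoints_def induced_matching_def)
  then show ?thesis
    using homeomorphic_cross_polytope_sphere[OF _ \<open>0 < n\<close>] indep_number_matching
      homeomorphic_imp_homotopy_equivalent_space homotopy_eqv_trans by metis
qed

lemma dismantles_to_isolated: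
  assumes "dismantles n W W'" "finite W" and x: "x \<in> W'" "\<And>v. v \<in> W' \<Longrightarrow> \<not> adj x v"
  shows "contractible_space (geometric_realization (indep W)) \<and> indep_number W = 0"
proof -
  obtain a b where
    *: "\<forall>u\<in>endpoints n a b. \<forall>v\<in>W'. \<not> adj u v" "finite W'"
      "geometric_realization (indep W) homotopy_equivalent_space
        geometric_realization (indep (endpoints n a b \<union> W'))"
      "indep_number W = indep_number (endpoints n a b \<union> W')"
    using dismantles_realization[OF assms(1,2), of 0 undefined undefined]
    by (auto simp: endpoints_def induced_matching_def)
  have fin: "finite (endpoints n a b \<union> W')" using * by (simp add: endpoints_def)
  have iso: "\<not> adj x v" if "v \<in> endpoints n a b \<union> W'" for v
    using that * x adj_sym by blast
  show ?thesis
    using contractible_cone[OF fin _ iso] indep_number_isolated[OF fin _ iso] x(1) *(4)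
      homotopy_equivalent_space_contractibility[OF *(3)] by auto
qed

end

section \<open>The square grid by columns\<close>
definition grid_adj :: "int \<times> int \<Rightarrow> int \<times> int \<Rightarrow> bool" where
  "grid_adj u v \<longleftrightarrow> {u, v} \<in> edges square_grid"

lemma grid_adj_iff:
  "grid_adj (x, y) w \<longleftrightarrow> w = (x + 1, y) \<or> w = (x - 1, y) \<or> w = (x, y + 1) \<or> w = (x, y - 1)"
  by (cases w) (auto simp: grid_adj_def grid_adjacent_iff)

interpretation grid: simple_graph grid_adj
proof
  show "grid_adj v u" if "grid_adj u v" for u v
    using that by (simp add: grid_adj_def insert_commute)
  show "\<not> grid_adj v v" for v
    by (cases v) (simp add: grid_adj_iff)
qed

text \<open>
  Vertex sets are described by a predicate of the column \<open>s = x + y\<close> and the height \<open>y\<close>. All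
  conditions then compare a column or a height with a bound.
\<close>
definition region :: "(int \<Rightarrow> int \<Rightarrow> bool) \<Rightarrow> (int \<times> int) set" where
  "region P = {(x, y). P (x + y) y}"

definition col_adj :: "int \<Rightarrow> int \<Rightarrow> int \<Rightarrow> int \<Rightarrow> bool" where
  "col_adj s y s' y' \<longleftrightarrow> s' = s + 1 \<and> (y' = y \<or> y' = y + 1) \<or> s' = s - 1 \<and> (y' = y \<or> y' = y - 1)"

lemma grid_adj_columns: "grid_adj (x, y) (x', y') \<longleftrightarrow> col_adj (x + y) y (x' + y') y'"
  unfolding grid_adj_iff col_adj_def by auto

text \<open>
  A vertex without neighbours to the left and below has at most its right and upper neighbours,
  and these are also neighbours of the vertex diagonally above it, two columns further.
\<close>
lemma corner_folds:
  assumes fin: "finite (region P)" and sub: "\<And>s y. P' s y \<Longrightarrow> P s y"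
    and corner: "\<And>s y. P s y \<Longrightarrow> \<not> P' s y \<Longrightarrow>
      P' (s - 2) (y - 1) \<and> \<not> P (s - 3) (y - 1) \<and> \<not> P (s - 3) (y - 2)"
  shows "grid.dismantles 0 (region P) (region P')"
proof -
  let ?W = "region P" and ?W' = "region P'"
  have "\<exists>u\<in>?W - (?W - ?W'). \<forall>w\<in>?W. grid_adj u w \<longrightarrow> grid_adj v w" if "v \<in> ?W - ?W'" for v
  proof -
    obtain x y where v: "v = (x, y)" by fastforce
    have *: "P' (x - 1 + (y - 1)) (y - 1)" "\<not> P (x - 2 + (y - 1)) (y - 1)" "\<not> P (x - 1 + (y - 2)) (y - 2)"
      using corner[of "x + y" y] that v by (auto simp: region_def algebra_simps)
    have "grid_adj v w" if "w \<in> ?W" "grid_adj (x - 1, y - 1) w" for w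
      using that * unfolding v grid_adj_iff by (auto simp: region_def)
    then show ?thesis
      using * sub by (intro bexI[of _ "(x - 1, y - 1)"]) (auto simp: region_def)
  qed
  then have "grid.dismantles 0 ?W (?W - (?W - ?W'))"
    using fin by (intro grid.dismantles_folds) auto
  moreover have "?W - (?W - ?W') = ?W'" using sub by (auto simp: region_def)
  ultimately show ?thesis by simp
qed

text \<open>
  A descending path that alternates between the columns \<open>s\<close> and \<open>s + 1\<close>. It starts at height \<open>c\<close>, in
  column \<open>s\<close> if \<open>e = 0\<close> and in column \<open>s + 1\<close> if \<open>e = 1\<close>. It ends at height \<open>d\<close>, in column \<open>s + 1\<close>
  if \<open>e' = 0\<close> and in column \<open>s\<close> if \<open>e' = 1\<close>.
\<close>
definition zigzag :: "int \<Rightarrow> int \<Rightarrow> int \<Rightarrow> int \<Rightarrow> int \<Rightarrow> int \<Rightarrow> int \<Rightarrow> bool" where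
  "zigzag s c d e e' s' y \<longleftrightarrow> s' = s \<and> d \<le> y \<and> y \<le> c - e \<or> s' = s + 1 \<and> d + e' \<le> y \<and> y \<le> c"

text \<open>
  The number of vertices of the path is \<open>3 * n - 1\<close>, as \<open>dismantles_path\<close> requires. The assumption
  \<open>top\<close> makes its first vertex a leaf; \<open>left\<close> and \<open>right\<close> say that it is attached to the remaining graph
  only at its last vertex. The conditions \<open>cols\<close> describe the remaining set column by column:
  besides the path, the neighbours of its last vertex have to go. A path with \<open>3 * n\<close> vertices is
  covered as well, since its last vertex is then a neighbour of the last one but one.
\<close>
lemma dismantles_zigzag:
  assumes fin: "finite (region P)" and e: "e \<in> {0, 1}" "e' \<in> {0, 1}" and dc: "d \<le> c"
    and n: "3 * int n = 2 * (c - d + 1) + 1 - e - e'"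
    and sub: "\<And>y. d \<le> y \<Longrightarrow> y \<le> c - e \<Longrightarrow> P s y" "\<And>y. d + e' \<le> y \<Longrightarrow> y \<le> c \<Longrightarrow> P (s + 1) y"
    and top: "\<not> P (s + 1 - e) (c + 1 - e)"
    and left: "\<And>y. d \<le> y \<Longrightarrow> y \<le> c - e \<Longrightarrow> \<not> P (s - 1) y \<and> \<not> P (s - 1) (y - 1)"
    and right: "\<And>y. d + 1 \<le> y \<Longrightarrow> y \<le> c \<Longrightarrow> \<not> P (s + 2) y \<and> \<not> P (s + 2) (y + 1)"
    and cols: "\<And>y. P' s y \<longleftrightarrow> P s y \<and> \<not> (d - 1 + e' \<le> y \<and> y \<le> c - e)"
      "\<And>y. P' (s + 1) y \<longleftrightarrow> P (s + 1) y \<and> \<not> (d \<le> y \<and> y \<le> c)"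
      "\<And>y. P' (s + 2) y \<longleftrightarrow> P (s + 2) y \<and> \<not> (e' = 0 \<and> d \<le> y \<and> y \<le> d + 1)"
      "\<And>t y. t < s \<or> s + 2 < t \<Longrightarrow> P' t y \<longleftrightarrow> P t y"
  shows "grid.dismantles n (region P) (region P')"
proof -
  let ?Z = "region (zigzag s c d e e')"
  \<comment> \<open>The number of vertices, \<open>2\<close> modulo \<open>3\<close>, rules out a path with fewer than two of them.\<close>
  have short: "d < c \<or> e = 0 \<and> e' = 0"
  proof (rule ccontr)
    assume "\<not> ?thesis"
    then have "d = c" "e = 1 \<or> e' = 1" using dc e by auto
    then have "3 * int n = 1 \<or> 3 * int n = 2" using n e by auto
    then show False by presburger
  qed
  have de: "d \<le> c - e" "d + e' \<le> c" using e short dc by auto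
  have e'01: "e' = 0 \<or> e' = 1" using e by simp
  have P': "P' t y \<longleftrightarrow> P t y \<and> \<not> zigzag s c d e e' t y \<and> \<not> col_adj (s + 1 - e') d t y" for t y
  proof -
    consider "t = s" | "t = s + 1" | "t = s + 2" | "t = s - 1" | "t < s - 1 \<or> s + 2 < t" by linarith
    then show ?thesis
    proof cases
      case 1
      then show ?thesis using cols(1)[of y] de e'01 by (elim disjE; auto simp: zigzag_def col_adj_def)
    next
      case 2
      then show ?thesis using cols(2)[of y] de e'01 by (elim disjE; auto simp: zigzag_def col_adj_def)
    next
      case 3
      then show ?thesis using cols(3)[of y] de e'01 by (elim disjE; auto simp: zigzag_def col_adj_def)
    next
      case 4
      then have "e' = 1 \<Longrightarrow> \<not> P (s - 1) d \<and> \<not> P (s - 1) (d - 1)" using left[of d] de by simp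
      then show ?thesis using de cols(4)[of t y] 4 e'01 by (elim disjE; auto simp: zigzag_def col_adj_def)
    next
      case 5
      then show ?thesis using cols(4)[of t y] e'01 by (auto simp: zigzag_def col_adj_def)
    qed
  qed
  have closed: "zigzag s c d e e' s'' y'"
    if z: "zigzag s c d e e' s' y" and last: "s' \<noteq> s + 1 - e' \<or> y \<noteq> d"
      and P: "P s'' y'" and adj: "col_adj s' y s'' y'" for s' y s'' y'
  proof -
    consider "s' = s" "d + e' \<le> y" "y \<le> c - e" | "s' = s + 1" "d + 1 \<le> y" "y \<le> c"
      using z last e by (auto simp: zigzag_def)
    then show ?thesis
    proof cases
      case 1
      then have "s'' = s + 1" "y' = y \<or> y' = y + 1"
        using left[of y] P adj e'01 by (auto simp: col_adj_def)
      moreover have "y' \<noteq> c + 1" if "e = 0" using that top P \<open>s'' = s + 1\<close> by auto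
      ultimately show ?thesis using 1 e by (auto simp: zigzag_def)
    next
      case 2
      then have "s'' = s" "y' = y \<or> y' = y - 1"
        using right[of y] P adj by (auto simp: col_adj_def add.commute)
      moreover have "y' \<noteq> c" if "e = 1" using that top P \<open>s'' = s\<close> by auto
      ultimately show ?thesis using 2 e by (auto simp: zigzag_def)
    qed
  qed
  have "0 < 3 * int n" unfolding n using e dc by auto
  then obtain t where t: "n = Suc t" by (cases n) auto
  \<comment> \<open>The \<open>i\<close>-th vertex lies \<open>q i\<close> below the top, in column \<open>s + r i\<close>; the offset \<open>e\<close> skips the missing start.\<close>
  define q where "q = (\<lambda>i. (int i + e) div 2)"
  define r where "r = (\<lambda>i. (int i + e) mod 2)"
  define p where "p = (\<lambda>i. (s + r i - (c - q i), c - q i))"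
  have qr: "int i + e = 2 * q i + r i" "r i = 0 \<or> r i = 1" for i
    by (auto simp: q_def r_def)
  have len: "2 * (c - d) = 3 * int t + e + e'" using n t by auto
  have pZ: "p i \<in> ?Z" if "i \<le> 3 * t + 1" for i
    using that e len qr[of i] unfolding p_def region_def zigzag_def by auto
  have pl: "p (3 * t + 1) = (s + 1 - e' - d, d)"
    using e len qr[of "3 * t + 1"] unfolding p_def by auto
  have pinj: "inj p"
  proof (rule injI)
    fix i j assume "p i = p j"
    then show "i = j" using qr[of i] qr[of j] by (simp add: p_def)
  qed
  have onto: "\<exists>i\<le>3 * t + 1. (x, y) = p i" if "(x, y) \<in> ?Z" for x y
  proof -
    define i where "i = nat (2 * (c - y) + (x + y - s) - e)"
    have "0 \<le> 2 * (c - y) + (x + y - s) - e"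
      using that e unfolding region_def zigzag_def by auto
    then have i: "int i = 2 * (c - y) + (x + y - s) - e" by (simp add: i_def)
    have "x + y = s \<or> x + y = s + 1" using that by (auto simp: region_def zigzag_def)
    then consider (even) "int i + e = 2 * (c - y)" "x = s - y" | (odd) "int i + e = 2 * (c - y) + 1" "x = s + 1 - y"
      using i by linarith
    then have "(x, y) = p i"
    proof cases
      case even
      show ?thesis unfolding p_def q_def r_def even by simp
    next
      case odd
      have *: "(2 * z + 1) div 2 = z \<and> (2 * z + 1) mod 2 = 1" for z :: int by simp
      show ?thesis unfolding p_def q_def r_def odd using *[of "c - y"] by (simp only:) simp
    qed
    moreover have "int i \<le> 3 * int t + 1"
      using that e len i unfolding region_def zigzag_def by auto
    ultimately show ?thesis by (intro exI[of _ i]) simp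
  qed
  have img: "p ` {..3 * t + 1} = ?Z"
  proof (intro equalityI subsetI)
    fix v assume "v \<in> ?Z"
    then obtain i where "i \<le> 3 * t + 1" "v = p i" using onto[of "fst v" "snd v"] by auto
    then show "v \<in> p ` {..3 * t + 1}" by blast
  qed (use pZ in auto)
  have nbr: "i = Suc j \<or> j = Suc i" if "grid_adj (p i) (p j)" for i j
    using that qr[of i] qr[of j] unfolding p_def grid_adj_iff by auto
  have step: "grid_adj (p i) (p (Suc i))" for i
    using qr[of i] qr[of "Suc i"] unfolding p_def grid_adj_iff by auto
  have inZ: "\<exists>j\<le>3 * t + 1. w = p j \<and> (i = Suc j \<or> j = Suc i)"
    if "i \<le> 3 * t" "w \<in> region P" "grid_adj (p i) w" for i w
  proof -
    have "p i \<noteq> p (3 * t + 1)" using pinj that(1) by (auto dest: injD)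
    then have "w \<in> ?Z"
      using closed[of "fst (p i) + snd (p i)" "snd (p i)" "fst w + snd w" "snd w"] pZ[of i] that pl
      by (cases w; cases "p i") (auto simp: region_def grid_adj_columns)
    then show ?thesis using onto[of "fst w" "snd w"] nbr that(3) by auto
  qed
  have sub': "?Z \<subseteq> region P" using sub by (auto simp: region_def zigzag_def)
  have "grid.dismantles (Suc t) (region P) (region P - p ` {..3 * t + 1} - {w. grid_adj (p (3 * t + 1)) w})"
  proof (rule grid.dismantles_path[OF fin])
    show "w = p 1" if "w \<in> region P" "grid_adj (p 0) w" for w
      using inZ[OF _ that] by auto
    show "w = p i \<or> w = p (Suc (Suc i))" if "Suc i \<le> 3 * t" "w \<in> region P" "grid_adj (p (Suc i)) w" for i w
      using inZ[OF that] by auto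
  qed (use pZ sub' pinj step in \<open>auto intro: inj_on_subset\<close>)
  moreover have "region P' = region P - ?Z - {w. grid_adj (s + 1 - e' - d, d) w}"
    by (auto simp: region_def P' grid_adj_columns)
  ultimately show ?thesis unfolding img pl t by simp
qed

section \<open>Strips and their reductions\<close>

text \<open>
  A reduction works at the left end of a strip, so the right end \<open>N\<close> stays fixed while the left end \<open>a\<close>
  moves. The first column may be partial: \<open>lower_strip\<close> keeps its lowest \<open>j\<close> vertices,
  \<open>upper_strip\<close> lacks them.
\<close>
definition strip :: "int \<Rightarrow> int \<Rightarrow> int \<Rightarrow> int \<Rightarrow> int \<Rightarrow> bool" where
  "strip K N a s y \<longleftrightarrow> 0 \<le> y \<and> y < K \<and> a \<le> s \<and> s < N"

definition lower_strip :: "int \<Rightarrow> int \<Rightarrow> int \<Rightarrow> int \<Rightarrow> int \<Rightarrow> int \<Rightarrow> bool" where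
  "lower_strip K N a j s y \<longleftrightarrow> strip K N a s y \<and> (s = a \<longrightarrow> y < j)"

definition upper_strip :: "int \<Rightarrow> int \<Rightarrow> int \<Rightarrow> int \<Rightarrow> int \<Rightarrow> int \<Rightarrow> bool" where
  "upper_strip K N a j s y \<longleftrightarrow> strip K N a s y \<and> (s = a \<longrightarrow> j \<le> y)"

lemma finite_sub_strip:
  assumes "\<And>s y. P s y \<Longrightarrow> strip K N a s y"
  shows "finite (region P)"
  by (rule finite_subset[of _ "{a - K..N} \<times> {0..K}"])
    (use assms in \<open>force simp: strip_def region_def\<close>, simp)

text \<open>
  The first column clears the third one except for its lowest vertex. The zigzag path through the
  first two columns has \<open>2K \<equiv> 2\<close> vertices modulo \<open>3\<close> and ends next to that vertex, which it takes along.
\<close>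
lemma strip_drop_3:
  assumes "0 < K" and "a + 2 \<le> N" and m: "3 * int m = 2 * K + 1"
  shows "grid.dismantles m (region (strip K N a)) (region (strip K N (a + 3)))"
proof -
  define P where "P = (\<lambda>s y. strip K N a s y \<and> (s = a + 2 \<longrightarrow> y = 0))"
  note defs = P_def strip_def
  have fin: "finite (region (strip K N a))" "finite (region P)"
    by (rule finite_sub_strip[of _ K N a]; simp add: defs)+
  have "grid.dismantles 0 (region (strip K N a)) (region P)"
    by (rule corner_folds[OF fin(1)]) (auto simp: defs)
  moreover have "grid.dismantles m (region P) (region (strip K N (a + 3)))"
    by (rule dismantles_zigzag[OF fin(2), where s = a and c = "K - 1" and d = 0 and e = 0 and e' = 0])
      (use assms in \<open>auto simp: defs \<close>)
  ultimately show ?thesis using grid.dismantles_trans by fastforce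
qed

text \<open>Here \<open>2K \<equiv> 0\<close> modulo \<open>3\<close>: the path vanishes completely and the lowest vertex of the third column survives.\<close>
lemma strip_to_lower_strip:
  assumes "0 < K" and "a + 2 \<le> N" and m: "3 * int m = 2 * K"
  shows "grid.dismantles m (region (strip K N a)) (region (lower_strip K N (a + 2) 1))"
proof -
  define P where "P = (\<lambda>s y. strip K N a s y \<and> (s = a + 2 \<longrightarrow> y = 0))"
  note defs = P_def strip_def lower_strip_def
  have fin: "finite (region (strip K N a))" "finite (region P)"
    by (rule finite_sub_strip[of _ K N a]; simp add: defs)+
  have "grid.dismantles 0 (region (strip K N a)) (region P)"
    by (rule corner_folds[OF fin(1)]) (auto simp: defs)
  moreover have "grid.dismantles m (region P) (region (lower_strip K N (a + 2) 1))"
    by (rule dismantles_zigzag[OF fin(2), where s = a and c = "K - 1" and d = 0 and e = 0 and e' = 1])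
      (use assms in \<open>auto simp: defs \<close>)
  ultimately show ?thesis using grid.dismantles_trans by fastforce
qed

text \<open>
  The partial first column clears the middle of the third one, and the upper part of the second
  column clears the top of the fourth. The zigzag path that descends through the upper parts of the
  second and third columns ends in the third column and detaches the lower part of the
  figure. There the first two columns form a path that removes the last vertex of the third.
  The fourth column keeps one vertex more than the first one had.
\<close>
lemma lower_strip_drop_3_gain_1:
  assumes "1 \<le> j" "j < K - 1" and "a + 3 \<le> N"
    and n: "3 * int n = 2 * (K - j - 1) + 1" and m: "3 * int m = 2 * j + 1"
  shows "grid.dismantles (n + m) (region (lower_strip K N a j)) (region (lower_strip K N (a + 3) (j + 1)))"
proof -
  define P where "P = (\<lambda>s y. lower_strip K N a j s y \<and>
    (s = a + 2 \<longrightarrow> y = 0 \<or> j + 1 \<le> y) \<and> (s = a + 3 \<longrightarrow> y \<le> j + 1))"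
  define Q where "Q = (\<lambda>s y. lower_strip K N a j s y \<and>
    (s = a + 1 \<longrightarrow> y < j) \<and> (s = a + 2 \<longrightarrow> y = 0) \<and> (s = a + 3 \<longrightarrow> y \<le> j))"
  note defs = P_def Q_def strip_def lower_strip_def
  have fin: "finite (region (lower_strip K N a j))" "finite (region P)" "finite (region Q)"
    by (rule finite_sub_strip[of _ K N a]; simp add: defs)+
  have 1: "grid.dismantles 0 (region (lower_strip K N a j)) (region P)"
    by (rule corner_folds[OF fin(1)]) (use assms(1-3) in \<open>auto simp: defs\<close>)
  have 2: "grid.dismantles n (region P) (region Q)"
    by (rule dismantles_zigzag[OF fin(2), where s = "a + 1" and c = "K - 1" and d = "j + 1" and e = 0 and e' = 0])
      (use assms(1-3) in \<open>auto simp: defs n\<close>)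
  have 3: "grid.dismantles m (region Q) (region (lower_strip K N (a + 3) (j + 1)))"
    by (rule dismantles_zigzag[OF fin(3), where s = a and c = "j - 1" and d = 0 and e = 0 and e' = 0])
      (use assms(1-3) in \<open>auto simp: defs m\<close>)
  show ?thesis
    using grid.dismantles_trans[OF grid.dismantles_trans[OF 1 2] 3] by simp
qed

text \<open>
  The same reduction for the other length modulo \<open>3\<close>: the upper path vanishes completely, and the fourth
  column keeps the vertex at height \<open>j + 1\<close>.
\<close>
lemma lower_strip_drop_3_gain_2:
  assumes "1 \<le> j" "j < K - 1" and "a + 3 \<le> N"
    and n: "3 * int n = 2 * (K - j - 1)" and m: "3 * int m = 2 * (j + 1)"
  shows "grid.dismantles (n + m) (region (lower_strip K N a j)) (region (lower_strip K N (a + 3) (j + 2)))"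
proof -
  define P where "P = (\<lambda>s y. lower_strip K N a j s y \<and>
    (s = a + 2 \<longrightarrow> y = 0 \<or> j + 1 \<le> y) \<and> (s = a + 3 \<longrightarrow> y \<le> j + 1))"
  define Q where "Q = (\<lambda>s y. lower_strip K N a j s y \<and>
    (s = a + 1 \<longrightarrow> y \<le> j) \<and> (s = a + 2 \<longrightarrow> y = 0) \<and> (s = a + 3 \<longrightarrow> y \<le> j + 1))"
  note defs = P_def Q_def strip_def lower_strip_def
  have fin: "finite (region (lower_strip K N a j))" "finite (region P)" "finite (region Q)"
    by (rule finite_sub_strip[of _ K N a]; simp add: defs)+
  have 1: "grid.dismantles 0 (region (lower_strip K N a j)) (region P)"
    by (rule corner_folds[OF fin(1)]) (use assms(1-3) in \<open>auto simp: defs\<close>)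
  have 2: "grid.dismantles n (region P) (region Q)"
    by (rule dismantles_zigzag[OF fin(2), where s = "a + 1" and c = "K - 1" and d = "j + 1" and e = 0 and e' = 1])
      (use assms(1-3) in \<open>auto simp: defs n\<close>)
  have 3: "grid.dismantles m (region Q) (region (lower_strip K N (a + 3) (j + 2)))"
    by (rule dismantles_zigzag[OF fin(3), where s = a and c = j and d = 0 and e = 1 and e' = 0])
      (use assms(1-3) in \<open>auto simp: defs m\<close>)
  show ?thesis
    using grid.dismantles_trans[OF grid.dismantles_trans[OF 1 2] 3] by simp
qed

text \<open>
  When the first column lacks only its top vertex, the first two columns already form a single
  path, and the fourth column is not touched.
\<close>
lemma lower_strip_drop_3_last:
  assumes "2 \<le> K" and "a + 2 \<le> N" and m: "3 * int m = 2 * K"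
  shows "grid.dismantles m (region (lower_strip K N a (K - 1))) (region (strip K N (a + 3)))"
proof -
  define P where "P = (\<lambda>s y. lower_strip K N a (K - 1) s y \<and> (s = a + 2 \<longrightarrow> y = 0))"
  note defs = P_def strip_def lower_strip_def
  have fin: "finite (region (lower_strip K N a (K - 1)))" "finite (region P)"
    by (rule finite_sub_strip[of _ K N a]; simp add: defs)+
  have 1: "grid.dismantles 0 (region (lower_strip K N a (K - 1))) (region P)"
    by (rule corner_folds[OF fin(1)]) (use assms(1-2) in \<open>auto simp: defs\<close>)
  have 2: "grid.dismantles m (region P) (region (strip K N (a + 3)))"
    by (rule dismantles_zigzag[OF fin(2), where s = a and c = "K - 1" and d = 0 and e = 1 and e' = 0])
      (use assms(1-2) in \<open>auto simp: defs m\<close>)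
  show ?thesis using grid.dismantles_trans[OF 1 2] by simp
qed

text \<open>
  Since \<open>2K \<equiv> 1\<close> modulo \<open>3\<close>, the path through the first two columns leaves the lowest vertex of the second
  column over. This is a leaf at the lowest vertex of the third column, and removing that edge costs the
  two lowest vertices of the fourth column.
\<close>
lemma strip_to_upper_strip_aux:
  assumes "2 \<le> K" and "a + 3 \<le> N" and m: "3 * int m = 2 * K - 1"
  shows "grid.dismantles (m + 1) (region (strip K N a)) (region (upper_strip K N (a + 3) 2))"
proof -
  define P where "P = (\<lambda>s y. strip K N a s y \<and> (s = a + 2 \<longrightarrow> y = 0))"
  define Q where "Q = (\<lambda>s y. strip K N (a + 1) s y \<and> (s \<le> a + 2 \<longrightarrow> y = 0))"
  note defs = P_def Q_def strip_def upper_strip_def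
  have fin: "finite (region (strip K N a))" "finite (region P)" "finite (region Q)"
    by (rule finite_sub_strip[of _ K N a]; simp add: defs)+
  have 1: "grid.dismantles 0 (region (strip K N a)) (region P)"
    by (rule corner_folds[OF fin(1)]) (use assms(1-2) in \<open>auto simp: defs\<close>)
  have 2: "grid.dismantles m (region P) (region Q)"
    by (rule dismantles_zigzag[OF fin(2), where s = a and c = "K - 1" and d = 1 and e = 0 and e' = 0])
      (use assms(1-2) in \<open>auto simp: defs m\<close>)
  have 3: "grid.dismantles 1 (region Q) (region (upper_strip K N (a + 3) 2))"
    by (rule dismantles_zigzag[OF fin(3), where s = "a + 1" and c = 0 and d = 0 and e = 0 and e' = 0])
      (use assms(1-2) in \<open>auto simp: defs \<close>)
  show ?thesis
    using grid.dismantles_trans[OF grid.dismantles_trans[OF 1 2] 3] by simp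
qed

text \<open>
  The two intermediate stages between an upper strip and the next one. In the funnel, the lower parts
  of two columns form a path whose ends are attached to the bottom and to the upper part of the
  next column. The wide strip has two partial columns of the same height.
\<close>
definition funnel :: "int \<Rightarrow> int \<Rightarrow> int \<Rightarrow> int \<Rightarrow> int \<Rightarrow> int \<Rightarrow> bool" where
  "funnel K N a j s y \<longleftrightarrow> strip K N (a + 1) s y \<and> (s = a + 1 \<longrightarrow> y < j) \<and> (s = a + 2 \<longrightarrow> y \<le> j) \<and>
     (s = a + 3 \<longrightarrow> y = 0 \<or> j < y)"

definition wide_strip :: "int \<Rightarrow> int \<Rightarrow> int \<Rightarrow> int \<Rightarrow> int \<Rightarrow> int \<Rightarrow> bool" where
  "wide_strip K N a j s y \<longleftrightarrow> strip K N a s y \<and> (s \<le> a + 1 \<longrightarrow> y < j)"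

text \<open>
  The path through the first column and the part of the second that faces it vanishes
  completely. What is left of the second column then clears the middle of the fourth.
\<close>
lemma upper_strip_to_funnel:
  assumes "1 \<le> j" "j < K" and "a + 3 \<le> N" and n: "3 * int n = 2 * (K - j)"
  shows "grid.dismantles n (region (upper_strip K N a j)) (region (funnel K N a j))"
proof -
  define P where "P = (\<lambda>s y. upper_strip K N a j s y \<and> (s = a + 2 \<longrightarrow> y \<le> j))"
  define Q where "Q = (\<lambda>s y. strip K N (a + 1) s y \<and>
    (s = a + 1 \<longrightarrow> y < j) \<and> (s = a + 2 \<longrightarrow> y \<le> j))"
  note defs = P_def Q_def strip_def upper_strip_def funnel_def
  have fin: "finite (region (upper_strip K N a j))" "finite (region P)" "finite (region Q)"
    by (rule finite_sub_strip[of _ K N a]; simp add: defs)+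
  have 1: "grid.dismantles 0 (region (upper_strip K N a j)) (region P)"
    by (rule corner_folds[OF fin(1)]) (use assms(1-3) in \<open>auto simp: defs\<close>)
  have 2: "grid.dismantles n (region P) (region Q)"
    by (rule dismantles_zigzag[OF fin(2), where s = a and c = "K - 1" and d = j and e = 0 and e' = 1])
      (use assms(1-3) in \<open>auto simp: defs n\<close>)
  have 3: "grid.dismantles 0 (region Q) (region (funnel K N a j))"
    by (rule corner_folds[OF fin(3)]) (use assms(1-3) in \<open>auto simp: defs\<close>)
  show ?thesis
    using grid.dismantles_trans[OF grid.dismantles_trans[OF 1 2] 3] by simp
qed

lemma funnel_to_empty:
  assumes "1 \<le> j" "j < K" and "N = a + 3" and n: "3 * int n = 2 * (j + 1)"
  shows "grid.dismantles n (region (funnel K N a j)) {}"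
proof -
  note defs = strip_def funnel_def
  have fin: "finite (region (funnel K N a j))"
    by (rule finite_sub_strip[of _ K N a]; simp add: defs)+
  have "grid.dismantles n (region (funnel K N a j)) (region (\<lambda>_ _. False))"
    by (rule dismantles_zigzag[OF fin, where s = "a + 1" and c = j and d = 0 and e = 1 and e' = 0])
      (use assms(1-3) in \<open>auto simp: defs n\<close>)
  then show ?thesis by (simp add: region_def)
qed

text \<open>
  The upper parts of the columns \<open>a + 3\<close> and \<open>a + 4\<close> form a path whose removal cuts the upper end of the
  path in the columns \<open>a + 1\<close> and \<open>a + 2\<close>. That one then starts with a leaf, and its removal takes
  away the bottom vertex of column \<open>a + 3\<close>.
\<close>
lemma funnel_to_wide_strip:
  assumes "1 \<le> j" "j < K - 2" and "a + 5 \<le> N"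
    and n: "3 * int n = 2 * (K - j) - 3" and m: "3 * int m = 2 * (j + 1)"
  shows "grid.dismantles (n + m) (region (funnel K N a j)) (region (wide_strip K N (a + 4) (j + 2)))"
proof -
  define P where "P = (\<lambda>s y. funnel K N a j s y \<and> (s = a + 5 \<longrightarrow> y \<le> j + 2))"
  define Q where "Q = (\<lambda>s y. strip K N (a + 1) s y \<and> (s = a + 1 \<longrightarrow> y < j) \<and> (s = a + 2 \<longrightarrow> y \<le> j) \<and>
    (s = a + 3 \<longrightarrow> y = 0) \<and> (a + 4 \<le> s \<and> s \<le> a + 5 \<longrightarrow> y < j + 2))"
  note defs = P_def Q_def strip_def funnel_def wide_strip_def
  have fin: "finite (region (funnel K N a j))" "finite (region P)" "finite (region Q)"
    by (rule finite_sub_strip[of _ K N a]; simp add: defs)+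
  have 1: "grid.dismantles 0 (region (funnel K N a j)) (region P)"
    by (rule corner_folds[OF fin(1)]) (use assms(1-3) in \<open>auto simp: defs\<close>)
  have 2: "grid.dismantles n (region P) (region Q)"
    by (rule dismantles_zigzag[OF fin(2), where s = "a + 3" and c = "K - 1" and d = "j + 2" and e = 0 and e' = 0])
      (use assms(1-3) in \<open>auto simp: defs n\<close>)
  have 3: "grid.dismantles m (region Q) (region (wide_strip K N (a + 4) (j + 2)))"
    by (rule dismantles_zigzag[OF fin(3), where s = "a + 1" and c = j and d = 0 and e = 1 and e' = 0])
      (use assms(1-3) in \<open>auto simp: defs m\<close>)
  show ?thesis
    using grid.dismantles_trans[OF grid.dismantles_trans[OF 1 2] 3] by simp
qed

lemma wide_strip_to_upper_strip:
  assumes "1 \<le> j" "j < K" and "a + 2 \<le> N" and n: "3 * int n = 2 * j + 1"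
  shows "grid.dismantles n (region (wide_strip K N a j)) (region (upper_strip K N (a + 2) (j + 1)))"
proof -
  define P where "P = (\<lambda>s y. wide_strip K N a j s y \<and> (s = a + 2 \<longrightarrow> y = 0 \<or> j < y))"
  note defs = P_def strip_def upper_strip_def wide_strip_def
  have fin: "finite (region (wide_strip K N a j))" "finite (region P)"
    by (rule finite_sub_strip[of _ K N a]; simp add: defs)+
  have 1: "grid.dismantles 0 (region (wide_strip K N a j)) (region P)"
    by (rule corner_folds[OF fin(1)]) (use assms(1-3) in \<open>auto simp: defs\<close>)
  have 2: "grid.dismantles n (region P) (region (upper_strip K N (a + 2) (j + 1)))"
    by (rule dismantles_zigzag[OF fin(2), where s = a and c = "j - 1" and d = 0 and e = 0 and e' = 0])
      (use assms(1-3) in \<open>auto simp: defs n\<close>)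
  show ?thesis using grid.dismantles_trans[OF 1 2] by simp
qed

section \<open>Complete reductions\<close>
definition conical :: "(int \<times> int) set \<Rightarrow> bool" where
  "conical W \<longleftrightarrow> (\<exists>n W' x. grid.dismantles n W W' \<and> x \<in> W' \<and> (\<forall>v\<in>W'. \<not> grid_adj x v))"

lemma conical_trans: "grid.dismantles n W W' \<Longrightarrow> conical W' \<Longrightarrow> conical W"
  unfolding conical_def using grid.dismantles_trans by blast

lemma conical_region:
  assumes "P s y" "\<not> P (s + 1) y" "\<not> P (s + 1) (y + 1)" "\<not> P (s - 1) y" "\<not> P (s - 1) (y - 1)"
  shows "conical (region P)"
proof -
  have "\<not> grid_adj (s - y, y) v" if "v \<in> region P" for v
  proof (cases v)
    case (Pair x' y')
    then show ?thesis using that assms by (auto simp: region_def grid_adj_columns col_adj_def)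
  qed
  moreover have "(s - y, y) \<in> region P" using assms by (simp add: region_def)
  ultimately show ?thesis unfolding conical_def using grid.dismantles.refl by blast
qed

lemma obtain_third:
  assumes "z mod 3 = 0" "0 \<le> z"
  obtains n where "3 * int n = (z :: int)"
  using that[of "nat (z div 3)"] assms by auto

lemma strip_empty: "N \<le> a \<Longrightarrow> region (strip K N a) = {}"
  and lower_strip_empty: "N \<le> a \<Longrightarrow> region (lower_strip K N a j) = {}"
  and upper_strip_empty: "N \<le> a \<Longrightarrow> region (upper_strip K N a j) = {}"
  by (auto simp: region_def strip_def lower_strip_def upper_strip_def)

text \<open>Iterates a reduction by one full period of the width.\<close>
lemma strip_periods:
  assumes "\<And>a. a + T \<le> N \<Longrightarrow> grid.dismantles c (region (strip K N a)) (region (strip K N (a + T)))"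
    and "0 \<le> T" and "a + int q * T \<le> N"
  shows "grid.dismantles (q * c) (region (strip K N a)) (region (strip K N (a + int q * T)))"
  using assms(3)
proof (induction q arbitrary: a)
  case 0
  then show ?case by (simp add: grid.dismantles.refl)
next
  case (Suc q)
  have "0 \<le> int q * T" using \<open>0 \<le> T\<close> by simp
  then have 1: "grid.dismantles c (region (strip K N a)) (region (strip K N (a + T)))"
    using Suc.prems by (intro assms(1)) (simp add: algebra_simps)
  have 2: "grid.dismantles (q * c) (region (strip K N (a + T))) (region (strip K N (a + T + int q * T)))"
    using Suc.prems by (intro Suc.IH) (simp add: algebra_simps)
  show ?case using grid.dismantles_trans[OF 1 2] by (simp add: algebra_simps)
qed

subsection \<open>Height congruent to 1\<close>
lemma strip_mod_1_dismantles_to_empty: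
  assumes "0 < K" "3 * int m = 2 * K + 1" and "N = a + 3 * int t \<or> N = a + 3 * int t - 1"
  shows "grid.dismantles (t * m) (region (strip K N a)) {}"
  using assms(3)
proof (induction t arbitrary: a)
  case 0
  then show ?case using strip_empty[of N a] grid.dismantles.refl by auto
next
  case (Suc t)
  have 1: "grid.dismantles m (region (strip K N a)) (region (strip K N (a + 3)))"
    by (rule strip_drop_3) (use assms Suc.prems in auto)
  have 2: "grid.dismantles (t * m) (region (strip K N (a + 3))) {}"
    by (rule Suc.IH) (use Suc.prems in auto)
  show ?case using grid.dismantles_trans[OF 1 2] by simp
qed

lemma strip_mod_1_conical:
  assumes "0 < K" "3 * int m = 2 * K + 1" and "N = a + 3 * int t + 1"
  shows "conical (region (strip K N a))"
  using assms(3)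
proof (induction t arbitrary: a)
  case 0
  then show ?case using \<open>0 < K\<close> by (intro conical_region[of _ a 0]) (auto simp: strip_def)
next
  case (Suc t)
  have 1: "grid.dismantles m (region (strip K N a)) (region (strip K N (a + 3)))"
    by (rule strip_drop_3) (use assms Suc.prems in auto)
  show ?case by (rule conical_trans[OF 1 Suc.IH]) (use Suc.prems in auto)
qed

subsection \<open>Height divisible by 3\<close>

text \<open>The two path lengths in \<open>lower_strip_drop_3_gain_1\<close> add up to \<open>m\<close> edges, independently of \<open>j\<close>.\<close>
lemma lower_strip_gain_1:
  assumes "j mod 3 = 1" "1 \<le> j" "j < K - 1" "K mod 3 = 0" "a + 3 \<le> N" and m: "3 * int m = 2 * K"
  shows "grid.dismantles m (region (lower_strip K N a j)) (region (lower_strip K N (a + 3) (j + 1)))"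
proof -
  have "(2 * (K - j - 1) + 1) mod 3 = 0" "0 \<le> 2 * (K - j - 1) + 1" using assms(1,4) assms(2,3) by presburger+
  from obtain_third[OF this] obtain n where n1: "3 * int n = 2 * (K - j - 1) + 1" by blast
  have "(2 * j + 1) mod 3 = 0" "0 \<le> 2 * j + 1" using assms(1,4) assms(2,3) by presburger+
  from obtain_third[OF this] obtain n' where n2: "3 * int n' = 2 * j + 1" by blast
  note n = n1 n2
  have "int m = int (n + n')" using n m by simp
  then have "m = n + n'" by (simp only: of_nat_eq_iff)
  then show ?thesis using lower_strip_drop_3_gain_1[OF assms(2,3,5) n] by simp
qed

lemma lower_strip_gain_2:
  assumes "j mod 3 = 2" "1 \<le> j" "j < K" "K mod 3 = 0" "a + 3 \<le> N \<or> j = K - 1 \<and> a + 2 \<le> N"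
    and m: "3 * int m = 2 * K"
  shows "grid.dismantles m (region (lower_strip K N a j)) (region (lower_strip K N (a + 3) (j + 2)))"
proof (cases "j = K - 1")
  case True
  have "lower_strip K N (a + 3) (j + 2) = strip K N (a + 3)"
    using True by (auto simp: fun_eq_iff lower_strip_def strip_def)
  then show ?thesis using lower_strip_drop_3_last[of K a N m] True assms by auto
next
  case False
  have "(2 * (K - j - 1)) mod 3 = 0" "0 \<le> 2 * (K - j - 1)" using assms(1,4) assms(2,3) by presburger+
  from obtain_third[OF this] obtain n where n1: "3 * int n = 2 * (K - j - 1)" by blast
  have "(2 * (j + 1)) mod 3 = 0" "0 \<le> 2 * (j + 1)" using assms(1,4) assms(2,3) by presburger+
  from obtain_third[OF this] obtain n' where n2: "3 * int n' = 2 * (j + 1)" by blast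
  note n = n1 n2
  have "int m = int (n + n')" using n m by simp
  then have "m = n + n'" by (simp only: of_nat_eq_iff)
  then show ?thesis using lower_strip_drop_3_gain_2[of j K a N, OF _ _ _ n] False assms by auto
qed

context
  fixes K N :: int and m :: nat
  assumes K0: "K mod 3 = 0" and m0: "3 * int m = 2 * K"
begin

text \<open>
  Two steps add three vertices to the partial column, so the residue of \<open>j\<close> modulo \<open>3\<close> recurs. The
  exceptional width \<open>5\<close> is enough for the last pair because its second step needs one column less.
\<close>
lemma lower_strip_drop_6:
  assumes "j mod 3 = 1" "1 \<le> j" "j < K - 1" "a + 6 \<le> N \<or> j = K - 2 \<and> a + 5 \<le> N"
  shows "grid.dismantles (2 * m) (region (lower_strip K N a j)) (region (lower_strip K N (a + 6) (j + 3)))"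
proof -
  have 1: "grid.dismantles m (region (lower_strip K N a j)) (region (lower_strip K N (a + 3) (j + 1)))"
    by (rule lower_strip_gain_1) (use assms K0 m0 in auto)
  have "(j + 1) mod 3 = 2" using assms(1) by presburger
  then have 2: "grid.dismantles m (region (lower_strip K N (a + 3) (j + 1)))
      (region (lower_strip K N (a + 3 + 3) (j + 1 + 2)))"
    by (rule lower_strip_gain_2) (use assms K0 m0 in auto)
  show ?thesis using grid.dismantles_trans[OF 1 2] by (simp add: mult_2 add.assoc)
qed

text \<open>
  The width may be one less than the number of columns removed, since the last step uses only two
  of its three columns. If the third one is absent, the resulting strip is empty.
\<close>
lemma lower_strip_descent:
  assumes "j mod 3 = 1" "1 \<le> j" "3 * int l = K + 1 - j" "a + 6 * int l - 1 \<le> N"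
  shows "grid.dismantles (2 * l * m) (region (lower_strip K N a j)) (region (strip K N (a + 6 * int l)))"
  using assms
proof (induction l arbitrary: a j)
  case 0
  then have "lower_strip K N a j = strip K N a"
    by (auto simp: fun_eq_iff lower_strip_def strip_def)
  then show ?case by (simp add: grid.dismantles.refl)
next
  case (Suc l)
  have 1: "grid.dismantles (2 * m) (region (lower_strip K N a j)) (region (lower_strip K N (a + 6) (j + 3)))"
    by (rule lower_strip_drop_6) (use Suc.prems in auto)
  have 2: "grid.dismantles (2 * l * m) (region (lower_strip K N (a + 6) (j + 3)))
      (region (strip K N (a + 6 + 6 * int l)))"
    by (rule Suc.IH) (use Suc.prems in auto)
  show ?case using grid.dismantles_trans[OF 1 2] by (simp add: algebra_simps)
qed

lemma lower_strip_dismantles_to_empty: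
  assumes "j mod 3 = 1" "1 \<le> j" "3 * int l = K + 1 - j" "t < 2 * l" "N = a + 3 * int t"
  shows "grid.dismantles (t * m) (region (lower_strip K N a j)) {}"
  using assms
proof (induction l arbitrary: a j t)
  case (Suc l)
  have "t = 0 \<or> t = 1 \<or> t = (t - 2) + 2" by arith
  then consider "t = 0" | "t = 1" | t' where "t = t' + 2" by blast
  then show ?case
  proof cases
    case 1
    then show ?thesis using Suc.prems lower_strip_empty[of N a] grid.dismantles.refl by auto
  next
    case 2
    have "grid.dismantles m (region (lower_strip K N a j)) (region (lower_strip K N (a + 3) (j + 1)))"
      by (rule lower_strip_gain_1) (use Suc.prems 2 K0 m0 in auto)
    then show ?thesis using 2 Suc.prems lower_strip_empty[of N "a + 3"] by simp
  next
    case 3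
    have 1: "grid.dismantles (2 * m) (region (lower_strip K N a j)) (region (lower_strip K N (a + 6) (j + 3)))"
      by (rule lower_strip_drop_6) (use Suc.prems 3 in auto)
    have 2: "grid.dismantles (t' * m) (region (lower_strip K N (a + 6) (j + 3))) {}"
      by (rule Suc.IH) (use Suc.prems 3 in auto)
    show ?thesis using grid.dismantles_trans[OF 1 2] by (simp only: 3 mult_2 distrib_right add.commute)
  qed
qed simp

lemma lower_strip_width_1_conical:
  assumes "0 < K" "0 < j" "N = a + 1"
  shows "conical (region (lower_strip K N a j))"
  using assms by (intro conical_region[of _ a 0]) (auto simp: lower_strip_def strip_def)

text \<open>The vertex at height \<open>j + 1\<close> of the second column has no neighbour in the partial first column.\<close>
lemma lower_strip_width_2_conical:
  assumes "0 \<le> j" "j < K - 1" "N = a + 2"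
  shows "conical (region (lower_strip K N a j))"
  using assms by (intro conical_region[of _ "a + 1" "j + 1"]) (auto simp: lower_strip_def strip_def)

lemma lower_strip_conical:
  assumes "j mod 3 = 1" "1 \<le> j" "3 * int l = K + 1 - j" "0 < N - a" "N - a < 6 * int l - 1" "(N - a) mod 3 \<noteq> 0"
  shows "conical (region (lower_strip K N a j))"
  using assms
proof (induction l arbitrary: a j)
  case (Suc l)
  have "N - a \<noteq> 3" "N - a \<noteq> 6" using Suc.prems(6) by auto
  then consider "N = a + 1" | "N = a + 2" | "N = a + 4" | "N = a + 5" | "a + 7 \<le> N"
    using Suc.prems(4) by linarith
  then show ?case
  proof cases
    case 1
    then show ?thesis using Suc.prems by (intro lower_strip_width_1_conical) auto
  next
    case 2
    then show ?thesis using Suc.prems by (intro lower_strip_width_2_conical) auto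
  next
    case 3
    have "grid.dismantles m (region (lower_strip K N a j)) (region (lower_strip K N (a + 3) (j + 1)))"
      by (rule lower_strip_gain_1) (use Suc.prems 3 K0 m0 in auto)
    moreover have "conical (region (lower_strip K N (a + 3) (j + 1)))"
      using Suc.prems 3 by (intro lower_strip_width_1_conical) auto
    ultimately show ?thesis by (rule conical_trans)
  next
    case 4
    have "grid.dismantles m (region (lower_strip K N a j)) (region (lower_strip K N (a + 3) (j + 1)))"
      by (rule lower_strip_gain_1) (use Suc.prems 4 K0 m0 in auto)
    moreover have "conical (region (lower_strip K N (a + 3) (j + 1)))"
      using Suc.prems 4 by (intro lower_strip_width_2_conical) auto
    ultimately show ?thesis by (rule conical_trans)
  next
    case 5
    have "(N - (a + 6)) mod 3 \<noteq> 0" using Suc.prems(6) by presburger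
    then have "conical (region (lower_strip K N (a + 6) (j + 3)))"
      by (intro Suc.IH) (use Suc.prems 5 in auto)
    moreover have "grid.dismantles (2 * m) (region (lower_strip K N a j)) (region (lower_strip K N (a + 6) (j + 3)))"
      by (rule lower_strip_drop_6) (use Suc.prems 5 in auto)
    ultimately show ?thesis using conical_trans by blast
  qed
qed simp

text \<open>The bound \<open>N + 1\<close> includes the width \<open>2K + 1\<close>, where a full period of edges is consumed as well.\<close>
lemma strip_mod_0_period:
  assumes "3 * int k = K" "0 < K" "a + (2 * K + 2) \<le> N + 1"
  shows "grid.dismantles ((2 * k + 1) * m) (region (strip K N a)) (region (strip K N (a + (2 * K + 2))))"
proof -
  have 1: "grid.dismantles m (region (strip K N a)) (region (lower_strip K N (a + 2) 1))"
    by (rule strip_to_lower_strip) (use assms m0 in auto)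
  have 2: "grid.dismantles (2 * k * m) (region (lower_strip K N (a + 2) 1))
      (region (strip K N (a + 2 + 6 * int k)))"
    by (rule lower_strip_descent) (use assms in auto)
  have eq: "a + 2 + 6 * int k = a + (2 * K + 2)" using assms(1) by simp
  have count: "m + 2 * k * m = (2 * k + 1) * m" by (simp add: algebra_simps)
  show ?thesis using grid.dismantles_trans[OF 1 2] unfolding eq count .
qed

lemma strip_mod_0_dismantles_to_empty:
  assumes "3 * int k = K" "0 < K" "N = a + 3 * int t + 2" "t < 2 * k"
  shows "grid.dismantles ((t + 1) * m) (region (strip K N a)) {}"
proof -
  have 1: "grid.dismantles m (region (strip K N a)) (region (lower_strip K N (a + 2) 1))"
    by (rule strip_to_lower_strip) (use assms m0 in auto)
  have 2: "grid.dismantles (t * m) (region (lower_strip K N (a + 2) 1)) {}"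
    by (rule lower_strip_dismantles_to_empty[of _ k]) (use assms in auto)
  show ?thesis using grid.dismantles_trans[OF 1 2] by simp
qed

lemma strip_mod_0_conical:
  assumes "3 * int k = K" "0 < K" "N = a + r" "r mod 3 = 0 \<and> 1 \<le> r \<or> r mod 3 = 1" "0 \<le> r" "r \<le> 2 * K"
  shows "conical (region (strip K N a))"
proof (cases "r = 1")
  case True
  then show ?thesis using assms by (intro conical_region[of _ a 0]) (auto simp: strip_def)
next
  case False
  have r: "3 \<le> r" "(N - (a + 2)) mod 3 \<noteq> 0"
    using assms False by presburger+
  have 1: "grid.dismantles m (region (strip K N a)) (region (lower_strip K N (a + 2) 1))"
    by (rule strip_to_lower_strip) (use assms r m0 in auto)
  have "conical (region (lower_strip K N (a + 2) 1))"
    by (rule lower_strip_conical[of _ k]) (use assms r in auto)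
  with 1 show ?thesis by (rule conical_trans)
qed

end

context
  fixes K N :: int and m :: nat
  assumes K2: "K mod 3 = 2" and m2: "3 * int m = 2 * K + 2"
begin

subsection \<open>Height congruent to 2\<close>

text \<open>
  The second path length is recorded here because the rest of the funnel contributes that many edges,
  no matter whether the strip ends right after it or continues.
\<close>
lemma upper_strip_to_funnel_count:
  assumes "j mod 3 = 2" "1 \<le> j" "j < K" "a + 3 \<le> N"
  obtains n n' where "3 * int n = 2 * (K - j)" "3 * int n' = 2 * (j + 1)" "n + n' = m"
    "grid.dismantles n (region (upper_strip K N a j)) (region (funnel K N a j))"
proof -
  have "(2 * (K - j)) mod 3 = 0" "0 \<le> 2 * (K - j)" using assms(1) K2 assms(2,3) by presburger+
  from obtain_third[OF this] obtain n where n1: "3 * int n = 2 * (K - j)" by blast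
  have "(2 * (j + 1)) mod 3 = 0" "0 \<le> 2 * (j + 1)" using assms(1) K2 assms(2,3) by presburger+
  from obtain_third[OF this] obtain n' where n2: "3 * int n' = 2 * (j + 1)" by blast
  note n = n1 n2
  have "int m = int (n + n')" using n m2 by simp
  then have "n + n' = m" by (simp only: of_nat_eq_iff)
  then show thesis using that n upper_strip_to_funnel[OF assms(2-4) n(1)] by blast
qed

lemma upper_strip_to_wide_strip:
  assumes "j mod 3 = 2" "1 \<le> j" "j < K" "a + 5 \<le> N"
  obtains n n' where "3 * int n' = 2 * (j + 2) + 1" "n + n' = 2 * m"
    "grid.dismantles n (region (upper_strip K N a j)) (region (wide_strip K N (a + 4) (j + 2)))"
proof -
  have "a + 3 \<le> N" using assms(4) by simp
  obtain n n' where n: "3 * int n = 2 * (K - j)" "3 * int n' = 2 * (j + 1)" "n + n' = m"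
    "grid.dismantles n (region (upper_strip K N a j)) (region (funnel K N a j))"
    using upper_strip_to_funnel_count[OF assms(1-3), of a] \<open>a + 3 \<le> N\<close> by blast
  have j: "j < K - 2" using assms(1,3) K2 by presburger
  have "(2 * (K - j) - 3) mod 3 = 0" "0 \<le> 2 * (K - j) - 3" using assms(1) K2 assms(2) j by presburger+
  from obtain_third[OF this] obtain k where k1: "3 * int k = 2 * (K - j) - 3" by blast
  have "(2 * (j + 2) + 1) mod 3 = 0" "0 \<le> 2 * (j + 2) + 1" using assms(1) K2 assms(2) j by presburger+
  from obtain_third[OF this] obtain k' where k2: "3 * int k' = 2 * (j + 2) + 1" by blast
  note k = k1 k2
  have "int (n + (k + n') + k') = int (2 * m)" using n(1,2) k m2 by simp
  then have "n + (k + n') + k' = 2 * m" by (simp only: of_nat_eq_iff)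
  then show thesis
    using that[of k' "n + (k + n')"] k(2)
      grid.dismantles_trans[OF n(4) funnel_to_wide_strip[OF assms(2) j assms(4) k(1) n(2)]] by blast
qed

lemma upper_strip_drop_6:
  assumes "j mod 3 = 2" "1 \<le> j" "j < K" "a + 6 \<le> N"
  shows "grid.dismantles (2 * m) (region (upper_strip K N a j)) (region (upper_strip K N (a + 6) (j + 3)))"
proof -
  have j: "j < K - 2" using assms(1,3) K2 by presburger
  have "a + 5 \<le> N" using assms(4) by simp
  obtain n n' where n: "3 * int n' = 2 * (j + 2) + 1" "n + n' = 2 * m"
    "grid.dismantles n (region (upper_strip K N a j)) (region (wide_strip K N (a + 4) (j + 2)))"
    using upper_strip_to_wide_strip[OF assms(1-3), of a] \<open>a + 5 \<le> N\<close> by blast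
  have "grid.dismantles n' (region (wide_strip K N (a + 4) (j + 2))) (region (upper_strip K N (a + 4 + 2) (j + 2 + 1)))"
    by (rule wide_strip_to_upper_strip) (use assms n j in auto)
  from grid.dismantles_trans[OF n(3) this] show ?thesis unfolding n(2) by (simp add: add.commute)
qed

lemma upper_strip_descent:
  assumes "j mod 3 = 2" "1 \<le> j" "3 * int l = K - j" "a + 6 * int l \<le> N"
  shows "grid.dismantles (2 * l * m) (region (upper_strip K N a j)) (region (strip K N (a + 6 * int l + 1)))"
  using assms
proof (induction l arbitrary: a j)
  case 0
  then have "upper_strip K N a j = strip K N (a + 1)"
    by (auto simp: fun_eq_iff upper_strip_def strip_def)
  then show ?case by (simp add: grid.dismantles.refl)
next
  case (Suc l)
  have 1: "grid.dismantles (2 * m) (region (upper_strip K N a j)) (region (upper_strip K N (a + 6) (j + 3)))"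
    by (rule upper_strip_drop_6) (use Suc.prems in auto)
  have 2: "grid.dismantles (2 * l * m) (region (upper_strip K N (a + 6) (j + 3)))
      (region (strip K N (a + 6 + 6 * int l + 1)))"
    by (rule Suc.IH) (use Suc.prems in auto)
  show ?case using grid.dismantles_trans[OF 1 2] by (simp add: algebra_simps)
qed

lemma upper_strip_dismantles_to_empty:
  assumes "j mod 3 = 2" "1 \<le> j" "3 * int l = K - j" "t \<le> 2 * l" "N = a + 3 * int t"
  shows "grid.dismantles (t * m) (region (upper_strip K N a j)) {}"
  using assms
proof (induction l arbitrary: a j t)
  case 0
  then show ?case using upper_strip_empty[of N a] grid.dismantles.refl by auto
next
  case (Suc l)
  have "t = 0 \<or> t = 1 \<or> t = (t - 2) + 2" by arith
  then consider "t = 0" | "t = 1" | t' where "t = t' + 2" by blast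
  then show ?case
  proof cases
    case 1
    then show ?thesis using Suc.prems upper_strip_empty[of N a] grid.dismantles.refl by auto
  next
    case 2
    have "j < K" "a + 3 \<le> N" using Suc.prems(3,5) 2 by auto
    obtain n n' where n: "3 * int n = 2 * (K - j)" "3 * int n' = 2 * (j + 1)" "n + n' = m"
      "grid.dismantles n (region (upper_strip K N a j)) (region (funnel K N a j))"
      using upper_strip_to_funnel_count[OF Suc.prems(1,2) \<open>j < K\<close> \<open>a + 3 \<le> N\<close>] by blast
    have "grid.dismantles n' (region (funnel K N a j)) {}"
      by (rule funnel_to_empty) (use Suc.prems 2 n in auto)
    from grid.dismantles_trans[OF n(4) this] show ?thesis using 2 n(3) by simp
  next
    case 3
    have 1: "grid.dismantles (2 * m) (region (upper_strip K N a j)) (region (upper_strip K N (a + 6) (j + 3)))"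
      by (rule upper_strip_drop_6) (use Suc.prems 3 in auto)
    have 2: "grid.dismantles (t' * m) (region (upper_strip K N (a + 6) (j + 3))) {}"
      by (rule Suc.IH) (use Suc.prems 3 in auto)
    show ?thesis using grid.dismantles_trans[OF 1 2] by (simp only: 3 mult_2 distrib_right add.commute)
  qed
qed

lemma upper_strip_conical:
  assumes "j mod 3 = 2" "1 \<le> j" "3 * int l = K - j" "0 < N - a" "N - a < 6 * int l" "(N - a) mod 3 \<noteq> 0"
  shows "conical (region (upper_strip K N a j))"
  using assms
proof (induction l arbitrary: a j)
  case (Suc l)
  have "N - a \<noteq> 3" "N - a \<noteq> 6" using Suc.prems(6) by auto
  then consider "N = a + 1" | "N = a + 2" | "N = a + 4" | "N = a + 5" | "a + 7 \<le> N"
    using Suc.prems(4) by linarith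
  then show ?case
  proof cases
    case 1
    then show ?thesis using Suc.prems
      by (intro conical_region[of _ a "K - 1"]) (auto simp: upper_strip_def strip_def)
  next
    case 2
    then show ?thesis using Suc.prems
      by (intro conical_region[of _ "a + 1" 0]) (auto simp: upper_strip_def strip_def)
  next
    case 3
    have "j < K" "a + 3 \<le> N" using Suc.prems(3) 3 by auto
    then obtain n where "grid.dismantles n (region (upper_strip K N a j)) (region (funnel K N a j))"
      using upper_strip_to_funnel_count[OF Suc.prems(1,2)] by blast
    \<comment> \<open>In column \<open>a + 3\<close>, now the last one, only the vertices at heights \<open>0\<close> and \<open>j + 1\<close> have neighbours.\<close>
    moreover have "conical (region (funnel K N a j))"
      using Suc.prems 3 by (intro conical_region[of _ "a + 3" "j + 2"]) (auto simp: funnel_def strip_def)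
    ultimately show ?thesis by (rule conical_trans)
  next
    case 4
    have "j < K" "a + 5 \<le> N" using Suc.prems(3) 4 by auto
    then obtain n where "grid.dismantles n (region (upper_strip K N a j)) (region (wide_strip K N (a + 4) (j + 2)))"
      using upper_strip_to_wide_strip[OF Suc.prems(1,2)] by blast
    moreover have "conical (region (wide_strip K N (a + 4) (j + 2)))"
      using Suc.prems 4 by (intro conical_region[of _ "a + 4" 0]) (auto simp: wide_strip_def strip_def)
    ultimately show ?thesis by (rule conical_trans)
  next
    case 5
    have "(N - (a + 6)) mod 3 \<noteq> 0" using Suc.prems(6) by presburger
    then have "conical (region (upper_strip K N (a + 6) (j + 3)))"
      by (intro Suc.IH) (use Suc.prems 5 in auto)
    moreover have "grid.dismantles (2 * m) (region (upper_strip K N a j)) (region (upper_strip K N (a + 6) (j + 3)))"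
      by (rule upper_strip_drop_6) (use Suc.prems 5 in auto)
    ultimately show ?thesis using conical_trans by blast
  qed
qed simp

lemma strip_to_upper_strip:
  assumes "2 \<le> K" "a + 3 \<le> N"
  shows "grid.dismantles m (region (strip K N a)) (region (upper_strip K N (a + 3) 2))"
proof -
  have "(2 * K - 1) mod 3 = 0" using K2 by presburger
  then obtain n where n: "3 * int n = 2 * K - 1" using obtain_third[of "2 * K - 1"] assms by auto
  have "int m = int (n + 1)" using n m2 by simp
  then have "m = n + 1" by (simp only: of_nat_eq_iff)
  then show ?thesis using strip_to_upper_strip_aux[OF assms n] by simp
qed

lemma strip_mod_2_period:
  assumes "3 * int k = K - 2" "2 \<le> K" "a + 2 * K \<le> N"
  shows "grid.dismantles ((2 * k + 1) * m) (region (strip K N a)) (region (strip K N (a + 2 * K)))"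
proof -
  have 1: "grid.dismantles m (region (strip K N a)) (region (upper_strip K N (a + 3) 2))"
    by (rule strip_to_upper_strip) (use assms in auto)
  have 2: "grid.dismantles (2 * k * m) (region (upper_strip K N (a + 3) 2))
      (region (strip K N (a + 3 + 6 * int k + 1)))"
    by (rule upper_strip_descent) (use assms in auto)
  have eq: "a + 3 + 6 * int k + 1 = a + 2 * K" using assms(1) by simp
  have count: "m + 2 * k * m = (2 * k + 1) * m" by (simp add: algebra_simps)
  show ?thesis using grid.dismantles_trans[OF 1 2] unfolding eq count .
qed

lemma strip_mod_2_dismantles_to_empty:
  assumes "3 * int k = K - 2" "2 \<le> K" "N = a + 3 * int t" "t \<le> 2 * k + 1"
  shows "grid.dismantles (t * m) (region (strip K N a)) {}"
proof (cases t)
  case 0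
  then show ?thesis using assms strip_empty[of N a] grid.dismantles.refl by auto
next
  case (Suc t')
  have 1: "grid.dismantles m (region (strip K N a)) (region (upper_strip K N (a + 3) 2))"
    by (rule strip_to_upper_strip) (use assms Suc in auto)
  have 2: "grid.dismantles (t' * m) (region (upper_strip K N (a + 3) 2)) {}"
    by (rule upper_strip_dismantles_to_empty[of _ k]) (use assms Suc in auto)
  show ?thesis using grid.dismantles_trans[OF 1 2] Suc by simp
qed

lemma strip_mod_2_conical:
  assumes "3 * int k = K - 2" "2 \<le> K" "N = a + r" "r mod 3 \<noteq> 0" "0 \<le> r" "r \<le> 2 * K - 1"
  shows "conical (region (strip K N a))"
proof -
  consider "r = 1" | "r = 2" | "3 \<le> r" using assms(4,5) by fastforce
  then show ?thesis
  proof cases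
    case 1
    then show ?thesis using assms by (intro conical_region[of _ a 0]) (auto simp: strip_def)
  next
    case 2
    \<comment> \<open>The path through the two columns has length 1 modulo 3 and ends in an isolated vertex.\<close>
    have "(2 * K - 1) mod 3 = 0" using K2 by presburger
    then obtain n where n: "3 * int n = 2 * K - 1" using obtain_third[of "2 * K - 1"] assms by auto
    have fin: "finite (region (strip K N a))" by (rule finite_sub_strip)
    have "grid.dismantles n (region (strip K N a)) (region (\<lambda>s y. s = a + 1 \<and> y = 0))"
      by (rule dismantles_zigzag[OF fin, where s = a and c = "K - 1" and d = 1 and e = 0 and e' = 0])
        (use assms(2,3) 2 in \<open>auto simp: strip_def n\<close>)
    moreover have "conical (region (\<lambda>s y. s = a + 1 \<and> y = 0))"
      by (rule conical_region[of _ "a + 1" 0]) auto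
    ultimately show ?thesis by (rule conical_trans)
  next
    case 3
    have 1: "grid.dismantles m (region (strip K N a)) (region (upper_strip K N (a + 3) 2))"
      by (rule strip_to_upper_strip) (use assms 3 in auto)
    have "(N - (a + 3)) mod 3 \<noteq> 0" "r \<noteq> 3" "r \<noteq> 2 * K - 1"
      using assms(3,4) K2 by presburger+
    then have "conical (region (upper_strip K N (a + 3) 2))"
      by (intro upper_strip_conical[of _ k]) (use assms 3 in auto)
    with 1 show ?thesis by (rule conical_trans)
  qed
qed

end

section \<open>The homotopy type of a parallelogram\<close>
lemma independence_complex_parallelogram:
  "independence_complex (parallelogram K N) = grid.indep (region (strip K N 0))"
proof -
  let ?V = "{(x, y). 0 \<le> y \<and> y \<le> K - 1 \<and> - y \<le> x \<and> x \<le> - y + N - 1}"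
  have V: "?V = region (strip K N 0)" by (auto simp: region_def strip_def)
  have E: "{u, v} \<in> edges (parallelogram K N) \<longleftrightarrow> grid_adj u v" if "u \<in> ?V" "v \<in> ?V" for u v
    using that by (simp add: parallelogram_def induced_subgraph_def edges_def grid_adj_def)
  have "independent_set (parallelogram K N) I \<longleftrightarrow> I \<in> grid.indep ?V" for I
    unfolding independent_set_def vertices_parallelogram grid.indep_def pairwise_def
    using E grid.adj_irrefl by (auto 0 3 simp: subset_iff)
  then show ?thesis unfolding independence_complex_def V by blast
qed

lemma finite_strip: "finite (region (strip K N a))"
  by (rule finite_sub_strip)

text \<open>
  A parallelogram with \<open>K, N \<ge> 1\<close> has a vertex, so some edge must have been split off: the
  dimension of the sphere is never negative.
\<close>
lemma parallelogram_sphere: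
  assumes "grid.dismantles (c * M) (region (strip K N 0)) {}" "0 < M" "1 \<le> K" "1 \<le> N"
  shows "geometric_realization (independence_complex (parallelogram K N))
      homotopy_equivalent_space nsphere (nat (int M * int c - 1)) \<and>
    alternating_number (parallelogram K N) = ((- 1) ^ M) ^ c"
proof -
  have "c \<noteq> 0"
  proof
    assume "c = 0"
    then have "region (strip K N 0) = {}"
      using assms(1) grid.dismantles_nonempty by auto
    moreover have "(0, 0) \<in> region (strip K N 0)" using assms by (simp add: region_def strip_def)
    ultimately show False by simp
  qed
  then have "0 < c * M" using \<open>0 < M\<close> by simp
  moreover have "nat (int M * int c - 1) = c * M - 1"
    by (simp add: nat_diff_distrib' nat_mult_distrib mult.commute)
  ultimately show ?thesis
    using grid.dismantles_to_empty[OF assms(1) finite_strip]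
    by (simp add: alternating_number_def independence_complex_parallelogram
        grid.indep_number_def mult.commute power_mult)
qed

lemma parallelogram_contractible:
  assumes "conical (region (strip K N 0))"
  shows "contractible_space (geometric_realization (independence_complex (parallelogram K N))) \<and>
    alternating_number (parallelogram K N) = 0"
  using assms grid.dismantles_to_isolated[OF _ finite_strip]
  unfolding conical_def alternating_number_def independence_complex_parallelogram
    grid.indep_number_def by blast

lemma ceiling_third: "\<lceil>real_of_int z / 3\<rceil> = (z + 2) div 3"
proof -
  have "\<lceil>real_of_int z / real_of_int 3\<rceil> = - (- z div 3)"
    by (rule ceiling_divide_eq_div)
  also have "\<dots> = (z + 2) div 3" by presburger
  finally show ?thesis by simp
qed

text \<open>
  For the remainder \<open>3t\<close>, the argument of the ceiling is an integer minus \<open>t / (2K)\<close>, and \<open>t < 2K\<close>.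
\<close>
lemma ceiling_count_mod_2:
  fixes K N k q t :: int
  assumes "K = 3 * k + 2" "0 \<le> k" "N = 2 * q * K + 3 * t" "0 \<le> t" "t \<le> 2 * k + 1"
  shows "\<lceil>(2 * real_of_int K - 1) / (2 * real_of_int K) * (real_of_int N / 3)\<rceil> = q * (2 * k + 1) + t"
proof (rule ceiling_unique)
  let ?K = "real_of_int K"
  have K: "?K = 3 * real_of_int k + 2" "0 < ?K" using assms by auto
  have eq: "(2 * ?K - 1) / (2 * ?K) * (real_of_int N / 3)
    = real_of_int (q * (2 * k + 1) + t) - real_of_int t / (2 * ?K)"
    using K unfolding assms(3) by (simp add: field_simps)
  have "real_of_int t < 2 * ?K" using K assms(2,5) by linarith
  then show "real_of_int (q * (2 * k + 1) + t) - 1 < (2 * ?K - 1) / (2 * ?K) * (real_of_int N / 3)"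
    using K unfolding eq by simp
  show "(2 * ?K - 1) / (2 * ?K) * (real_of_int N / 3) \<le> real_of_int (q * (2 * k + 1) + t)"
    using K assms(4) unfolding eq by simp
qed

text \<open>
  A full period contributes the integer \<open>(2K + 3) / 3\<close>, so it suffices to bound the contribution of the
  remainder.
\<close>
lemma ceiling_count_mod_0:
  fixes K N k q t r :: int
  assumes "K = 3 * k" "0 < k" "N = 2 * q * (K + 1) + r"
    and "real_of_int t - 1 < (2 * real_of_int K + 3) / (2 * real_of_int K + 2) * (real_of_int r / 3)"
    and "(2 * real_of_int K + 3) / (2 * real_of_int K + 2) * (real_of_int r / 3) \<le> real_of_int t"
  shows "\<lceil>(2 * real_of_int K + 3) / (2 * real_of_int K + 2) * (real_of_int N / 3)\<rceil> = q * (2 * k + 1) + t"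
proof (rule ceiling_unique)
  let ?K = "real_of_int K"
  have K: "?K = 3 * real_of_int k" "0 < ?K" using assms by auto
  have nz: "2 * ?K + 2 \<noteq> 0" using K by simp
  have Nr: "real_of_int N = real_of_int q * (2 * ?K + 2) + real_of_int r"
    unfolding assms(3) by (simp add: algebra_simps)
  have expand: "c * ((x * T + y) / 3) = c * T * x / 3 + c * (y / 3)" for c x T y :: real
    by (simp add: algebra_simps add_divide_distrib)
  have "(2 * ?K + 3) / (2 * ?K + 2) * (real_of_int N / 3)
    = (2 * ?K + 3) / (2 * ?K + 2) * (2 * ?K + 2) * real_of_int q / 3
      + (2 * ?K + 3) / (2 * ?K + 2) * (real_of_int r / 3)"
    unfolding Nr by (rule expand)
  also have "(2 * ?K + 3) / (2 * ?K + 2) * (2 * ?K + 2) * real_of_int q / 3 = real_of_int (q * (2 * k + 1))"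
    using nz K(1) by (simp add: field_simps)
  finally have eq: "(2 * ?K + 3) / (2 * ?K + 2) * (real_of_int N / 3)
    = real_of_int (q * (2 * k + 1)) + (2 * ?K + 3) / (2 * ?K + 2) * (real_of_int r / 3)" .
  show "real_of_int (q * (2 * k + 1) + t) - 1 < (2 * ?K + 3) / (2 * ?K + 2) * (real_of_int N / 3)"
    unfolding eq using assms(4) by simp
  show "(2 * ?K + 3) / (2 * ?K + 2) * (real_of_int N / 3) \<le> real_of_int (q * (2 * k + 1) + t)"
    unfolding eq using assms(5) by simp
qed

lemma quotient_nonneg:
  fixes N q T r :: int
  assumes "1 \<le> N" "N = q * T + r" "0 \<le> r" "r < T"
  shows "0 \<le> q"
proof (rule ccontr)
  assume "\<not> 0 \<le> q"
  then have "q * T \<le> - 1 * T" using assms by (intro mult_right_mono) auto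
  then show False using assms by linarith
qed

theorem theorem8:
  fixes K N m :: int and G :: "(int \<times> int) graph"
  assumes "1 \<le> K" and "1 \<le> N"
    and "m = \<lceil>2 * real_of_int K / 3\<rceil>"
    and "G = parallelogram K N"
  shows
    "(K mod 3 = 1 \<longrightarrow>
       (if N mod 3 = 1
        then contractible_space (geometric_realization (independence_complex G)) \<and>
             alternating_number G = 0
        else let n = \<lceil>real_of_int N / 3\<rceil> in
             geometric_realization (independence_complex G)
               homotopy_equivalent_space nsphere (nat (m * n - 1)) \<and>
             alternating_number G = (- 1) ^ nat n)) \<and>
     (K mod 3 = 2 \<longrightarrow>
       (\<forall>q r. N = 2 * q * K + r \<and> 0 \<le> r \<and> r \<le> 2 * K - 1 \<longrightarrow>
         (if r mod 3 = 1 \<or> r mod 3 = 2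
          then contractible_space (geometric_realization (independence_complex G)) \<and>
               alternating_number G = 0
          else let n = \<lceil>(2 * real_of_int K - 1) / (2 * real_of_int K) * (real_of_int N / 3)\<rceil> in
               geometric_realization (independence_complex G)
                 homotopy_equivalent_space nsphere (nat (m * n - 1)) \<and>
               alternating_number G = 1))) \<and>
     (K mod 3 = 0 \<longrightarrow>
       (\<forall>q r. N = 2 * q * (K + 1) + r \<and> 0 \<le> r \<and> r \<le> 2 * K + 1 \<longrightarrow>
         (if (r mod 3 = 0 \<and> 1 \<le> r) \<or> (r mod 3 = 1 \<and> r \<le> 2 * K)
          then contractible_space (geometric_realization (independence_complex G)) \<and>
               alternating_number G = 0
          else let n = \<lceil>(2 * real_of_int K + 3) / (2 * real_of_int K + 2) * (real_of_int N / 3)\<rceil> in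
               geometric_realization (independence_complex G)
                 homotopy_equivalent_space nsphere (nat (m * n - 1)) \<and>
               alternating_number G = 1)))"
proof (intro conjI impI allI)
  have "m = (2 * K + 2) div 3"
    using ceiling_third[of "2 * K"] assms(3) by simp
  then obtain M where M: "int M = (2 * K + 2) div 3" "m = int M" "0 < M"
    using assms(1) that[of "nat m"] by simp
  {
    assume K1: "K mod 3 = 1"
    have M1: "3 * int M = 2 * K + 1" using M(1) K1 by presburger
    then have "odd M" by presburger
    show "if N mod 3 = 1
        then contractible_space (geometric_realization (independence_complex G)) \<and>
             alternating_number G = 0
        else let n = \<lceil>real_of_int N / 3\<rceil> in
             geometric_realization (independence_complex G)
               homotopy_equivalent_space nsphere (nat (m * n - 1)) \<and>
             alternating_number G = (- 1) ^ nat n"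
    proof (cases "N mod 3 = 1")
      case True
      have "int (nat (N div 3)) = N div 3" using assms(2) by simp
      then have "N = 0 + 3 * int (nat (N div 3)) + 1" using True by presburger
      then have "conical (region (strip K N 0))"
        by (rule strip_mod_1_conical[OF _ M1, rotated]) (use assms(1) in simp)
      then show ?thesis using parallelogram_contractible True assms(4) by simp
    next
      case False
      define t where "t = nat ((N + 2) div 3)"
      have t: "int t = (N + 2) div 3" using assms(2) by (simp add: t_def)
      have "N = 0 + 3 * int t \<or> N = 0 + 3 * int t - 1" using t False by presburger
      then have "grid.dismantles (t * M) (region (strip K N 0)) {}"
        by (rule strip_mod_1_dismantles_to_empty[OF _ M1, rotated]) (use assms(1) in simp)
      from parallelogram_sphere[OF this M(3) assms(1,2)] show ?thesis
        using False \<open>odd M\<close> unfolding ceiling_third t[symmetric] assms(4) M(2) by simp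
    qed
  next
    fix q r
    assume K2: "K mod 3 = 2" and r: "N = 2 * q * K + r \<and> 0 \<le> r \<and> r \<le> 2 * K - 1"
    have M2: "3 * int M = 2 * K + 2" using M(1) K2 by presburger
    then have "even M" by presburger
    have "0 \<le> q" using quotient_nonneg[of N q "2 * K" r] r assms(2) by (simp add: mult.commute mult.left_commute)
    then obtain Q where Q: "q = int Q" using nonneg_int_cases by blast
    have "2 \<le> K" "(K - 2) mod 3 = 0" using K2 assms(1) by presburger+
    then obtain k where k: "3 * int k = K - 2" using obtain_third[of "K - 2"] by auto
    have period: "grid.dismantles (Q * ((2 * k + 1) * M)) (region (strip K N 0))
        (region (strip K N (0 + int Q * (2 * K))))"
      by (rule strip_periods) (use strip_mod_2_period[OF K2 M2 k \<open>2 \<le> K\<close>] r Q assms(1) in \<open>auto simp: algebra_simps\<close>)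
    have N: "N = (0 + int Q * (2 * K)) + r" using r Q by (simp add: algebra_simps)
    show "if r mod 3 = 1 \<or> r mod 3 = 2
          then contractible_space (geometric_realization (independence_complex G)) \<and>
               alternating_number G = 0
          else let n = \<lceil>(2 * real_of_int K - 1) / (2 * real_of_int K) * (real_of_int N / 3)\<rceil> in
               geometric_realization (independence_complex G)
                 homotopy_equivalent_space nsphere (nat (m * n - 1)) \<and>
               alternating_number G = 1"
    proof (cases "r mod 3 = 0")
      case False
      then have "conical (region (strip K N (0 + int Q * (2 * K))))"
        using strip_mod_2_conical[OF K2 M2 k \<open>2 \<le> K\<close> N] r by blast
      then have "conical (region (strip K N 0))" using conical_trans[OF period] by blast
      moreover have "r mod 3 = 1 \<or> r mod 3 = 2" using False by presburger
      ultimately show ?thesis using parallelogram_contractible assms(4) by simp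
    next
      case True
      then obtain t where t: "3 * int t = r" using obtain_third[of r] r by auto
      have t': "t \<le> 2 * k + 1" using t r k by linarith
      have "N = (0 + int Q * (2 * K)) + 3 * int t" using N t by simp
      from strip_mod_2_dismantles_to_empty[OF K2 M2 k \<open>2 \<le> K\<close> this t']
      have "grid.dismantles (Q * ((2 * k + 1) * M) + t * M) (region (strip K N 0)) {}"
        using grid.dismantles_trans[OF period] by blast
      then have d: "grid.dismantles ((Q * (2 * k + 1) + t) * M) (region (strip K N 0)) {}"
        by (simp add: algebra_simps)
      have n: "\<lceil>(2 * real_of_int K - 1) / (2 * real_of_int K) * (real_of_int N / 3)\<rceil>
          = int (Q * (2 * k + 1) + t)"
      proof -
        have "\<lceil>(2 * real_of_int K - 1) / (2 * real_of_int K) * (real_of_int N / 3)\<rceil>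
            = q * (2 * int k + 1) + int t"
          by (rule ceiling_count_mod_2) (use k r t t' in auto)
        then show ?thesis by (simp only: Q of_nat_add of_nat_mult of_nat_numeral of_nat_1)
      qed
      from parallelogram_sphere[OF d M(3) assms(1,2)] show ?thesis
        using True \<open>even M\<close> unfolding n Let_def assms(4) M(2) by simp
    qed
  next
    fix q r
    assume K0: "K mod 3 = 0" and r: "N = 2 * q * (K + 1) + r \<and> 0 \<le> r \<and> r \<le> 2 * K + 1"
    have M0: "3 * int M = 2 * K" using M(1) K0 by presburger
    then have "even M" by presburger
    have "0 \<le> q" using quotient_nonneg[of N q "2 * K + 2" r] r assms(2) by (simp add: algebra_simps)
    then obtain Q where Q: "q = int Q" using nonneg_int_cases by blast
    have "0 < K" using assms(1) by simp
    then obtain k where k: "3 * int k = K" using obtain_third[of K] K0 by auto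
    then have "0 < k" using \<open>0 < K\<close> by simp
    have period: "grid.dismantles (Q * ((2 * k + 1) * M)) (region (strip K N 0))
        (region (strip K N (0 + int Q * (2 * K + 2))))"
      by (rule strip_periods) (use strip_mod_0_period[OF K0 M0 k \<open>0 < K\<close>] r Q assms(1) in \<open>auto simp: algebra_simps\<close>)
    have N: "N = (0 + int Q * (2 * K + 2)) + r" using r Q by (simp add: algebra_simps)
    show "if (r mod 3 = 0 \<and> 1 \<le> r) \<or> (r mod 3 = 1 \<and> r \<le> 2 * K)
          then contractible_space (geometric_realization (independence_complex G)) \<and>
               alternating_number G = 0
          else let n = \<lceil>(2 * real_of_int K + 3) / (2 * real_of_int K + 2) * (real_of_int N / 3)\<rceil> in
               geometric_realization (independence_complex G)
                 homotopy_equivalent_space nsphere (nat (m * n - 1)) \<and>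
               alternating_number G = 1"
    proof (cases "(r mod 3 = 0 \<and> 1 \<le> r) \<or> (r mod 3 = 1 \<and> r \<le> 2 * K)")
      case True
      have "r \<le> 2 * K" using True r K0 by presburger
      then have "conical (region (strip K N (0 + int Q * (2 * K + 2))))"
        using strip_mod_0_conical[OF K0 M0 k \<open>0 < K\<close> N] r True by blast
      then have "conical (region (strip K N 0))" using conical_trans[OF period] by blast
      then show ?thesis using parallelogram_contractible assms(4) True by simp
    next
      case False
      let ?x = "(2 * real_of_int K + 3) / (2 * real_of_int K + 2) * (real_of_int r / 3)"
      have "\<exists>t. grid.dismantles (t * M) (region (strip K N (0 + int Q * (2 * K + 2)))) {} \<and>
          real_of_int (int t) - 1 < ?x \<and> ?x \<le> real_of_int (int t)"
      proof -
        have pos: "0 < 2 * real_of_int K + 2" using \<open>0 < K\<close> by simp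
        have "0 \<le> r" "r \<le> 2 * K + 1" using r by auto
        then have "r = 0 \<or> r = 2 * K + 1 \<or> r mod 3 = 2 \<and> r \<le> 2 * K \<and> r \<noteq> 2 * K"
          using False K0 by presburger
        then consider "r = 0" | "r = 2 * K + 1" | "r mod 3 = 2" "r \<le> 2 * K" "r \<noteq> 2 * K"
          by blast
        then show ?thesis
        proof cases
          case 1
          then have "region (strip K N (0 + int Q * (2 * K + 2))) = {}" using N by (intro strip_empty) simp
          then show ?thesis using 1 grid.dismantles.refl by (intro exI[of _ 0]) simp
        next
          case 2
          \<comment> \<open>A period covers \<open>2K + 2\<close> columns, but it also runs to its end on \<open>2K + 1\<close> of them.\<close>
          have "grid.dismantles ((2 * k + 1) * M) (region (strip K N (0 + int Q * (2 * K + 2))))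
              (region (strip K N (0 + int Q * (2 * K + 2) + (2 * K + 2))))"
            by (rule strip_mod_0_period[OF K0 M0 k \<open>0 < K\<close>]) (use N 2 in simp)
          moreover have "region (strip K N (0 + int Q * (2 * K + 2) + (2 * K + 2))) = {}"
            using N 2 by (intro strip_empty) simp
          moreover have "real_of_int K = 3 * real k" using k by linarith
          ultimately show ?thesis
            using pos 2 by (intro exI[of _ "2 * k + 1"]) (auto simp: field_simps)
        next
          case 3
          then have "(r - 2) mod 3 = 0" "0 \<le> r - 2" using \<open>0 \<le> r\<close> by presburger+
          from obtain_third[OF this] obtain t where t: "3 * int t = r - 2" by blast
          have "t < 2 * k" using t 3 k by linarith
          then have empty: "grid.dismantles ((t + 1) * M) (region (strip K N (0 + int Q * (2 * K + 2)))) {}"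
            by (intro strip_mod_0_dismantles_to_empty[OF K0 M0 k \<open>0 < K\<close>]) (use N t in auto)
          define d where "d = real_of_int r / (3 * (2 * real_of_int K + 2))"
          have x: "?x = real_of_int r / 3 + d"
            unfolding d_def using pos by (simp add: field_simps)
          have d: "0 \<le> d" "d \<le> 1 / 3"
            unfolding d_def using pos 3 \<open>0 \<le> r\<close> by (simp_all add: field_simps)
          have "real_of_int r = 3 * real t + 2" using t by linarith
          then have rt: "real_of_int r / 3 = real t + 2 / 3" by simp
          have x_t: "?x = real t + 2 / 3 + d"
            by (rule trans[OF x]) (simp only: rt)
          show ?thesis unfolding x_t
          proof (intro exI conjI)
            show "real_of_int (int (t + 1)) - 1 < real t + 2 / 3 + d"
              "real t + 2 / 3 + d \<le> real_of_int (int (t + 1))"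
              using d by simp_all
          qed (fact empty)
        qed
      qed
      then obtain t where t: "grid.dismantles (t * M) (region (strip K N (0 + int Q * (2 * K + 2)))) {}"
        "real_of_int (int t) - 1 < ?x" "?x \<le> real_of_int (int t)" by blast
      have d: "grid.dismantles ((Q * (2 * k + 1) + t) * M) (region (strip K N 0)) {}"
        using grid.dismantles_trans[OF period t(1)] by (simp add: algebra_simps)
      have n: "\<lceil>(2 * real_of_int K + 3) / (2 * real_of_int K + 2) * (real_of_int N / 3)\<rceil>
          = int (Q * (2 * k + 1) + t)"
      proof -
        have "\<lceil>(2 * real_of_int K + 3) / (2 * real_of_int K + 2) * (real_of_int N / 3)\<rceil>
            = q * (2 * int k + 1) + int t"
          by (rule ceiling_count_mod_0[OF k[symmetric] _ _ t(2,3)]) (use \<open>0 < k\<close> r in auto)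
        then show ?thesis by (simp only: Q of_nat_add of_nat_mult of_nat_numeral of_nat_1)
      qed
      from parallelogram_sphere[OF d M(3) assms(1,2)] show ?thesis
        using False \<open>even M\<close> unfolding n Let_def assms(4) M(2) by simp
    qed
  }
qed

end
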